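(* Every Demuth random sequence $X\in 2^\omega$ computes (i.e., is Turing above) some $1$-generic sequence $G \in 2^\omega$.
   Context: $2^\omega$ is the Cantor space of infinite binary sequences, and $\mu$ is the Lebesgue (uniform) measure on it, determined by $\mu([\sigma])=2^{-|\sigma|}$ for every finite binary string $\sigma$, where $[\sigma]$ is the set of $X\in 2^\omega$ having $\sigma$ as a prefix. An open set is effectively open if it is of the form $\bigcup_{\sigma\in S}[\sigma]$ for a computably enumerable set $S$ of strings. Fix an effective enumeration $(\mathcal{W}_e)_{e\in\omega}$ of all effectively open subsets of $2^\omega$. A function $g:\omega\to\omega$ is $\omega$-c.a. if it has a computable approximation $g(n,s)$ (so $\lim_s g(n,s)=g(n)$ for all $n$) and there is a computable function $h$ such that for every $n$ the number of $s$ with $g(n,s)\neq g(n,s+1)$ is at most $h(n)$. A Demuth test is a sequence $(\mathcal{W}_{g(n)})_{n\in\omega}$ where $g$ is an $\omega$-c.a. function and $\mu(\mathcal{W}_{g(n)})\leq 2^{-n}$ for all $n$. $X\in 2^\omega$ is Demuth random if for every Demuth test $(\mathcal{W}_{g(n)})_{n\in\omega}$, $X$ belongs to only finitely many of the sets $\mathcal{W}_{g(n)}$. $G\in 2^\omega$ is $1$-generic if for every computably enumerable set $S$ of finite binary strings, either some prefix of $G$ is in $S$ or some prefix of $G$ has no extension in $S$. *)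

theory Defs
  imports "HOL-Probability.Probability" "HOL-Library.Nat_Bijection" "HOL-Library.Sublist"
begin

section \<open>Partial computable functions relative to an oracle\<close>

type_synonym cantor = "nat \<Rightarrow> bool"

text \<open>
  Programs denote partial functions on the natural numbers; several arguments are passed
  through the Cantor pairing function \<open>prod_encode\<close>. Identity is \<open>PPair PFst PSnd\<close>, so the
  programs generate exactly the partial recursive functions in the oracle.
\<close>

datatype prog =
    PZero
  | PSucc
  | PFst
  | PSnd
  | POracle
  | PPair prog prog
  | PComp prog prog
  | PRec prog prog
  | PMin prog

text \<open>
  \<open>PRec f g\<close> maps the pair \<open>(a, k)\<close> to the \<open>k\<close>-th value of the primitive recursion with
  start value \<open>f a\<close> and step \<open>v \<mapsto> g (a, (i, v))\<close>. \<open>PMin f\<close> maps \<open>a\<close> to the first \<open>k\<close> with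
  \<open>f (a, k) = 0\<close>; all earlier values must be defined.
\<close>

primrec run :: "cantor \<Rightarrow> prog \<Rightarrow> nat \<Rightarrow> nat option" where
  "run A PZero n = Some 0"
| "run A PSucc n = Some (Suc n)"
| "run A PFst n = Some (fst (prod_decode n))"
| "run A PSnd n = Some (snd (prod_decode n))"
| "run A POracle n = Some (of_bool (A n))"
| "run A (PPair f g) n =
     Option.bind (run A f n) (\<lambda>x. Option.bind (run A g n) (\<lambda>y. Some (prod_encode (x, y))))"
| "run A (PComp f g) n = Option.bind (run A g n) (run A f)"
| "run A (PRec f g) n =
     (let (a, k) = prod_decode n in
      rec_nat (run A f a)
        (\<lambda>i r. Option.bind r (\<lambda>v. run A g (prod_encode (a, prod_encode (i, v))))) k)"
| "run A (PMin f) n =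
     (let stops = (\<lambda>k. run A f (prod_encode (n, k)) = Some 0 \<and>
                       (\<forall>j<k. \<exists>v>0. run A f (prod_encode (n, j)) = Some v)) in
      if \<exists>k. stops k then Some (LEAST k. stops k) else None)"

definition turing_le :: "cantor \<Rightarrow> cantor \<Rightarrow> bool" (infix "\<le>\<^sub>T" 50) where
  "G \<le>\<^sub>T X \<longleftrightarrow> (\<exists>p. \<forall>n. run X p n = Some (of_bool (G n)))"

text \<open>Unrelativized computability is computability with the empty oracle.\<close>

abbreviation no_oracle :: cantor where
  "no_oracle \<equiv> (\<lambda>_. False)"

definition computable :: "(nat \<Rightarrow> nat) \<Rightarrow> bool" where
  "computable f \<longleftrightarrow> (\<exists>p. \<forall>n. run no_oracle p n = Some (f n))"

definition computable2 :: "(nat \<Rightarrow> nat \<Rightarrow> nat) \<Rightarrow> bool" where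
  "computable2 f \<longleftrightarrow> computable (\<lambda>n. case prod_decode n of (x, y) \<Rightarrow> f x y)"

section \<open>Strings and effectively open sets\<close>

definition str_encode :: "bool list \<Rightarrow> nat" where
  "str_encode \<sigma> = list_encode (map of_bool \<sigma>)"

text \<open>
  Since the range of \<open>str_encode\<close> is decidable, a set of strings is of this form for some
  \<open>p\<close> iff the set of its codes is the domain of a partial computable function.
\<close>

definition halting_strings :: "prog \<Rightarrow> bool list set" where
  "halting_strings p = {\<sigma>. run no_oracle p (str_encode \<sigma>) \<noteq> None}"

definition ce_strings :: "bool list set \<Rightarrow> bool" where
  "ce_strings S \<longleftrightarrow> (\<exists>p. S = halting_strings p)"

definition is_prefix :: "bool list \<Rightarrow> cantor \<Rightarrow> bool" where
  "is_prefix \<sigma> X \<longleftrightarrow> (\<forall>i<length \<sigma>. X i = \<sigma> ! i)"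

definition cylinder :: "bool list \<Rightarrow> cantor set" where
  "cylinder \<sigma> = {X. is_prefix \<sigma> X}"

definition effectively_open :: "cantor set \<Rightarrow> bool" where
  "effectively_open U \<longleftrightarrow> (\<exists>S. ce_strings S \<and> U = (\<Union>\<sigma>\<in>S. cylinder \<sigma>))"

primrec goedel :: "prog \<Rightarrow> nat" where
  "goedel PZero = prod_encode (0, 0)"
| "goedel PSucc = prod_encode (1, 0)"
| "goedel PFst = prod_encode (2, 0)"
| "goedel PSnd = prod_encode (3, 0)"
| "goedel POracle = prod_encode (4, 0)"
| "goedel (PPair f g) = prod_encode (5, prod_encode (goedel f, goedel g))"
| "goedel (PComp f g) = prod_encode (6, prod_encode (goedel f, goedel g))"
| "goedel (PRec f g) = prod_encode (7, prod_encode (goedel f, goedel g))"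
| "goedel (PMin f) = prod_encode (8, goedel f)"

lemma goedel_inject: "goedel p = goedel q \<longleftrightarrow> p = q"
proof
  show "goedel p = goedel q \<Longrightarrow> p = q"
  proof (induction p arbitrary: q)
    case PZero then show ?case by (cases q) auto
  next
    case PSucc then show ?case by (cases q) auto
  next
    case PFst then show ?case by (cases q) auto
  next
    case PSnd then show ?case by (cases q) auto
  next
    case POracle then show ?case by (cases q) auto
  next
    case (PPair f g) then show ?case by (cases q) auto
  next
    case (PComp f g) then show ?case by (cases q) auto
  next
    case (PRec f g) then show ?case by (cases q) auto
  next
    case (PMin f) then show ?case by (cases q) auto
  qed
qed simp

text \<open>
  The standard numbering of the effectively open sets; a number that is not the code of a
  program is an index of the empty set.
\<close>

definition W :: "nat \<Rightarrow> cantor set" where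
  "W e = (\<Union>p\<in>{p. goedel p = e}. \<Union>\<sigma>\<in>halting_strings p. cylinder \<sigma>)"

lemma W_goedel: "W (goedel p) = (\<Union>\<sigma>\<in>halting_strings p. cylinder \<sigma>)"
  by (simp add: W_def goedel_inject)

lemma halting_strings_diverge: "halting_strings (PMin (PComp PSucc PZero)) = {}"
  by (simp add: halting_strings_def)

lemma range_W: "range W = {U. effectively_open U}"
proof (intro equalityI subsetI)
  fix U assume "U \<in> range W"
  then obtain e where e: "U = W e" by blast
  have "\<exists>p. U = (\<Union>\<sigma>\<in>halting_strings p. cylinder \<sigma>)"
  proof (cases "\<exists>p. goedel p = e")
    case True
    then show ?thesis using e W_goedel by blast
  next
    case False
    then have "U = {}" by (simp add: e W_def)
    then show ?thesis
      by (intro exI[of _ "PMin (PComp PSucc PZero)"]) (simp add: halting_strings_diverge)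
  qed
  then show "U \<in> {U. effectively_open U}"
    by (auto simp: effectively_open_def ce_strings_def)
next
  fix U assume "U \<in> {U. effectively_open U}"
  then show "U \<in> range W"
    by (auto simp: effectively_open_def ce_strings_def W_goedel[symmetric])
qed

section \<open>Uniform measure\<close>

definition coin_measure :: "cantor measure" where
  "coin_measure = (\<Pi>\<^sub>M i\<in>UNIV. measure_pmf (bernoulli_pmf (1/2)))"

lemma cylinder_eq_prod_emb:
  "cylinder \<sigma> = prod_emb UNIV (\<lambda>_. measure_pmf (bernoulli_pmf (1/2))) {..<length \<sigma>}
     (\<Pi>\<^sub>E i\<in>{..<length \<sigma>}. {\<sigma> ! i})"
  by (rule set_eqI) (simp add: cylinder_def is_prefix_def prod_emb_def PiE_iff Ball_def)

lemma cylinder_in_sets: "cylinder \<sigma> \<in> sets coin_measure"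
  unfolding cylinder_eq_prod_emb coin_measure_def
  by (intro sets_PiM_I) auto

lemma measure_cylinder: "measure coin_measure (cylinder \<sigma>) = (1/2) ^ length \<sigma>"
proof -
  interpret product_prob_space "\<lambda>_::nat. measure_pmf (bernoulli_pmf (1/2))" UNIV
    by unfold_locales
  have "measure coin_measure (cylinder \<sigma>) =
      (\<Prod>i<length \<sigma>. measure (measure_pmf (bernoulli_pmf (1/2))) {\<sigma> ! i})"
    unfolding cylinder_eq_prod_emb coin_measure_def
    by (rule measure_PiM_emb) auto
  also have "\<dots> = (\<Prod>i<length \<sigma>. 1/2)"
    by (intro prod.cong refl) (auto simp: measure_pmf_single pmf_bernoulli_half)
  finally show ?thesis by simp
qed

lemma W_in_sets: "W e \<in> sets coin_measure"
proof (cases "\<exists>p. goedel p = e")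
  case True
  then obtain p where "e = goedel p" by blast
  moreover have "(\<Union>\<sigma>\<in>halting_strings p. cylinder \<sigma>) \<in> sets coin_measure"
    by (intro sets.countable_UN') (auto simp: cylinder_in_sets)
  ultimately show ?thesis by (simp add: W_goedel)
next
  case False
  then show ?thesis by (simp add: W_def)
qed

section \<open>Demuth randomness and 1-genericity\<close>

definition omega_ca :: "(nat \<Rightarrow> nat) \<Rightarrow> bool" where
  "omega_ca g \<longleftrightarrow>
     (\<exists>ga h. computable2 ga \<and> (\<forall>n. \<forall>\<^sub>F s in sequentially. ga n s = g n) \<and>
             computable h \<and>
             (\<forall>n. finite {s. ga n s \<noteq> ga n (Suc s)} \<and>
                  card {s. ga n s \<noteq> ga n (Suc s)} \<le> h n))"

definition demuth_test :: "(nat \<Rightarrow> nat) \<Rightarrow> bool" where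
  "demuth_test g \<longleftrightarrow> omega_ca g \<and> (\<forall>n. measure coin_measure (W (g n)) \<le> (1/2) ^ n)"

definition demuth_random :: "cantor \<Rightarrow> bool" where
  "demuth_random X \<longleftrightarrow> (\<forall>g. demuth_test g \<longrightarrow> finite {n. X \<in> W (g n)})"

definition one_generic :: "cantor \<Rightarrow> bool" where
  "one_generic G \<longleftrightarrow>
     (\<forall>S. ce_strings S \<longrightarrow>
        (\<exists>\<sigma>. is_prefix \<sigma> G \<and> \<sigma> \<in> S) \<or>
        (\<exists>\<sigma>. is_prefix \<sigma> G \<and> (\<forall>\<tau>. prefix \<sigma> \<tau> \<longrightarrow> \<tau> \<notin> S)))"

end

theory Submission imports Defs begin

text \<open>
  The proof is a fireworks argument. The oracle \<open>X\<close> builds the prefixes of \<open>G\<close> and attends to all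
  c.e. sets \<open>S\<^sub>j\<close> in parallel. For each \<open>j\<close> it guesses that the current string has no extension in
  \<open>S\<^sub>j\<close>; when such a guess is refuted it guesses the same about the string reached meanwhile. After
  a number of refutations that is chosen by a block of \<open>m\<close> bits of \<open>X\<close>, it instead waits for an
  extension of the current string in \<open>S\<^sub>j\<close> to appear. The only way to fail is to wait in vain, and
  then the guess at which it started to wait would have been correct; so given the other bits of
  \<open>X\<close>, at most one of the \<open>2\<^sup>m\<close> choices is bad, and failure for \<open>j\<close> has measure at most \<open>2\<^sup>-\<^sup>m\<close>.
  Failure is ``waiting is started'' minus ``waiting is ended'', a difference of nested effectively
  open sets, and a sequence of such small differences is covered by a Demuth test. The block
  lengths also depend on a parameter \<open>c\<close>, in such a way that for large \<open>c\<close> a Demuth random \<open>X\<close> fails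
  for no \<open>j\<close> at all.
\<close>

section \<open>Closure properties of the total computable functions\<close>

text \<open>Whether a string extends into a c.e. set is not decidable in general, which is why the
  construction must guess. A correct guess is never confirmed but costs nothing; a wait in vain
  stops the work for every requirement. After a refutation, waiting and guessing again concern the
  same string \<open>m\<close>. So if two choices both waited in vain, the one that waits later
  would pass the string \<open>m\<close> of the other, guess there correctly, and never come to
  wait.

  Started minus ended waits need not be effectively open, because the ended ones are only
  approximated from below. Freezing them at a stage \<open>t\<close> gives an effectively open
  superset that may be too large, so \<open>t\<close> must be revised; each revision is paid for by
  growth of the started waits, and this bounds the revisions computably. The bound
  \<open>2^-(n+2)\<close> leaves two spare factors of 2: one is the gap between accepting and
  rejecting a \<open>t\<close>, the other makes the limiting difference strictly smaller than the
  acceptance threshold.\<close>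

definition computable_in :: "cantor \<Rightarrow> (nat \<Rightarrow> nat) \<Rightarrow> bool" where
  "computable_in A f \<longleftrightarrow> (\<exists>p. \<forall>n. run A p n = Some (f n))"

definition decidable_in :: "cantor \<Rightarrow> (nat \<Rightarrow> bool) \<Rightarrow> bool" where
  "decidable_in A P \<longleftrightarrow> computable_in A (\<lambda>n. of_bool (P n))"

abbreviation pair :: "nat \<Rightarrow> nat \<Rightarrow> nat" where
  "pair x y \<equiv> prod_encode (x, y)"

definition pfst :: "nat \<Rightarrow> nat" where
  "pfst n = fst (prod_decode n)"

definition psnd :: "nat \<Rightarrow> nat" where
  "psnd n = snd (prod_decode n)"

lemma pfst_pair [simp]: "pfst (pair x y) = x"
  and psnd_pair [simp]: "psnd (pair x y) = y"
  by (simp_all add: pfst_def psnd_def)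

lemma pair_pfst_psnd [simp]: "pair (pfst n) (psnd n) = n"
  by (simp add: pfst_def psnd_def)

lemma pair_0_0 [simp]: "pair 0 0 = 0"
  by (simp add: prod_encode_def)

lemma pfst_0 [simp]: "pfst 0 = 0" and psnd_0 [simp]: "psnd 0 = 0"
  using pfst_pair[of 0 0] psnd_pair[of 0 0] by simp_all

text \<open>These rules are stated with their arguments already composed, so that the syntax of a
  term alone determines the derivation of its computability.\<close>

named_theorems comp_intro

lemma computable_in_id [comp_intro]: "computable_in A (\<lambda>n. n)"
  unfolding computable_in_def by (rule exI[of _ "PPair PFst PSnd"]) simp

lemma computable_in_compose:
  assumes "computable_in A f" "computable_in A g"
  shows "computable_in A (\<lambda>n. f (g n))"
proof -
  obtain p q where "\<And>n. run A p n = Some (f n)" "\<And>n. run A q n = Some (g n)"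
    using assms unfolding computable_in_def by blast
  then show ?thesis
    unfolding computable_in_def by (intro exI[of _ "PComp p q"]) simp
qed

lemma computable_in_pfst [comp_intro]: "computable_in A f \<Longrightarrow> computable_in A (\<lambda>n. pfst (f n))"
  by (rule computable_in_compose[of A pfst])
    (auto simp: computable_in_def pfst_def intro!: exI[of _ PFst])

lemma computable_in_psnd [comp_intro]: "computable_in A f \<Longrightarrow> computable_in A (\<lambda>n. psnd (f n))"
  by (rule computable_in_compose[of A psnd])
    (auto simp: computable_in_def psnd_def intro!: exI[of _ PSnd])

lemma computable_in_Suc [comp_intro]: "computable_in A f \<Longrightarrow> computable_in A (\<lambda>n. Suc (f n))"
  by (rule computable_in_compose[of A Suc])
    (auto simp: computable_in_def intro!: exI[of _ PSucc])

lemma computable_in_const [comp_intro]: "computable_in A (\<lambda>n. k)"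
proof (induction k)
  case 0
  show ?case unfolding computable_in_def by (rule exI[of _ PZero]) simp
qed (rule computable_in_Suc)

lemma decidable_in_oracle [comp_intro]:
  assumes "computable_in A f"
  shows "decidable_in A (\<lambda>n. A (f n))"
  unfolding decidable_in_def
  by (rule computable_in_compose[of A "\<lambda>n. of_bool (A n)", OF _ assms])
    (auto simp: computable_in_def intro!: exI[of _ POracle])

lemma computable_in_pair [comp_intro]:
  assumes "computable_in A f" "computable_in A g"
  shows "computable_in A (\<lambda>n. pair (f n) (g n))"
proof -
  obtain p q where "\<And>n. run A p n = Some (f n)" "\<And>n. run A q n = Some (g n)"
    using assms unfolding computable_in_def by blast
  then show ?thesis
    unfolding computable_in_def by (intro exI[of _ "PPair p q"]) simp
qed

lemma computable_in_rec_nat [comp_intro]: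
  assumes "computable_in A a" "computable_in A k"
    "computable_in A (\<lambda>z. g (pfst z) (pfst (psnd z)) (psnd (psnd z)))"
  shows "computable_in A (\<lambda>n. rec_nat (a n) (g n) (k n))"
proof -
  obtain p q where pq: "\<And>n. run A p n = Some (a n)"
    "\<And>z. run A q z = Some (g (pfst z) (pfst (psnd z)) (psnd (psnd z)))"
    using assms unfolding computable_in_def by metis
  have rec: "rec_nat (Some (a n))
      (\<lambda>i r. Option.bind r (\<lambda>v. Some (g n i v))) k = Some (rec_nat (a n) (g n) k)" for n k
    by (induction k) simp_all
  have "computable_in A (\<lambda>z. rec_nat (a (pfst z)) (g (pfst z)) (psnd z))"
    unfolding computable_in_def
    by (rule exI[of _ "PRec p q"]) (simp add: pq rec split_beta flip: pfst_def psnd_def)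
  from computable_in_compose[OF this, of "\<lambda>n. pair n (k n)"] show ?thesis
    using computable_in_pair[OF computable_in_id assms(2)] by simp
qed

lemma computable_in_pred [comp_intro]:
  assumes "computable_in A f"
  shows "computable_in A (\<lambda>n. f n - 1)"
proof -
  have eq: "rec_nat 0 (\<lambda>i r. i) k = k - 1" for k by (cases k) auto
  have "computable_in A (\<lambda>n. rec_nat 0 (\<lambda>i r. i) (f n))"
    by (intro comp_intro assms)
  then show ?thesis by (simp only: eq)
qed

lemma computable_in_add [comp_intro]:
  assumes "computable_in A f" "computable_in A g"
  shows "computable_in A (\<lambda>n. f n + g n)"
proof -
  have eq: "rec_nat a (\<lambda>i r. Suc r) k = a + k" for a k by (induction k) auto
  have "computable_in A (\<lambda>n. rec_nat (f n) (\<lambda>i r. Suc r) (g n))"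
    by (intro comp_intro assms)
  then show ?thesis by (simp only: eq)
qed

lemma computable_in_diff [comp_intro]:
  assumes "computable_in A f" "computable_in A g"
  shows "computable_in A (\<lambda>n. f n - g n)"
proof -
  have eq: "rec_nat a (\<lambda>i r. r - 1) k = a - k" for a k by (induction k) auto
  have "computable_in A (\<lambda>n. rec_nat (f n) (\<lambda>i r. r - 1) (g n))"
    by (intro comp_intro assms)
  then show ?thesis by (simp only: eq)
qed

lemma computable_in_mult [comp_intro]:
  assumes "computable_in A f" "computable_in A g"
  shows "computable_in A (\<lambda>n. f n * g n)"
proof -
  have eq: "rec_nat 0 (\<lambda>i r. r + a) k = a * k" for a k by (induction k) auto
  have "computable_in A (\<lambda>n. rec_nat 0 (\<lambda>i r. r + f n) (g n))"
    by (intro comp_intro assms[THEN computable_in_compose])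
  then show ?thesis by (simp only: eq)
qed

lemma computable_in_power [comp_intro]:
  assumes "computable_in A f" "computable_in A g"
  shows "computable_in A (\<lambda>n. f n ^ g n)"
proof -
  have eq: "rec_nat 1 (\<lambda>i r. r * a) k = a ^ k" for a k :: nat by (induction k) auto
  have "computable_in A (\<lambda>n. rec_nat 1 (\<lambda>i r. r * f n) (g n))"
    by (intro comp_intro assms[THEN computable_in_compose])
  then show ?thesis by (simp only: eq)
qed

lemma computable_in_if [comp_intro]:
  assumes "decidable_in A P" "computable_in A f" "computable_in A g"
  shows "computable_in A (\<lambda>n. if P n then f n else g n)"
proof -
  have eq: "of_bool P * a + (1 - of_bool P) * b = (if P then a else b)" for P and a b :: nat
    by simp
  have "computable_in A (\<lambda>n. of_bool (P n) * f n + (1 - of_bool (P n)) * g n)"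
    using assms unfolding decidable_in_def by (intro comp_intro)
  then show ?thesis by (simp only: eq)
qed

lemma computable_in_of_bool [comp_intro]:
  "decidable_in A P \<Longrightarrow> computable_in A (\<lambda>n. of_bool (P n))"
  by (simp add: decidable_in_def)

lemma decidable_in_compose:
  "decidable_in A P \<Longrightarrow> computable_in A f \<Longrightarrow> decidable_in A (\<lambda>n. P (f n))"
  unfolding decidable_in_def by (rule computable_in_compose)

lemma decidable_in_eq_0:
  assumes "computable_in A f"
  shows "decidable_in A (\<lambda>n. f n = 0)"
proof -
  have eq: "of_bool (k = 0) = 1 - k" for k :: nat by simp
  show ?thesis unfolding decidable_in_def eq by (intro comp_intro assms)
qed

lemma decidable_in_le [comp_intro]:
  assumes "computable_in A f" "computable_in A g"
  shows "decidable_in A (\<lambda>n. f n \<le> g n)"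
  using decidable_in_eq_0[OF computable_in_diff[OF assms]] by simp

lemma decidable_in_less [comp_intro]:
  assumes "computable_in A f" "computable_in A g"
  shows "decidable_in A (\<lambda>n. f n < g n)"
  unfolding Suc_le_eq[symmetric] by (intro comp_intro assms)

lemma decidable_in_not [comp_intro]:
  assumes "decidable_in A P"
  shows "decidable_in A (\<lambda>n. \<not> P n)"
  using decidable_in_eq_0[OF assms[unfolded decidable_in_def]] by simp

lemma decidable_in_conj [comp_intro]:
  assumes "decidable_in A P" "decidable_in A Q"
  shows "decidable_in A (\<lambda>n. P n \<and> Q n)"
  unfolding decidable_in_def of_bool_conj
  by (intro comp_intro assms)

lemma decidable_in_disj [comp_intro]:
  assumes "decidable_in A P" "decidable_in A Q"
  shows "decidable_in A (\<lambda>n. P n \<or> Q n)"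
  using decidable_in_not[OF decidable_in_conj[OF decidable_in_not[OF assms(1)] decidable_in_not[OF assms(2)]]]
  by simp

lemma decidable_in_iff [comp_intro]:
  assumes "decidable_in A P" "decidable_in A Q"
  shows "decidable_in A (\<lambda>n. P n \<longleftrightarrow> Q n)"
proof -
  have "decidable_in A (\<lambda>n. (P n \<and> Q n) \<or> (\<not> P n \<and> \<not> Q n))"
    by (intro comp_intro assms)
  moreover have "((P n \<and> Q n) \<or> (\<not> P n \<and> \<not> Q n)) = (P n \<longleftrightarrow> Q n)" for n by blast
  ultimately show ?thesis by simp
qed

lemma decidable_in_eq [comp_intro]:
  assumes "computable_in A f" "computable_in A g"
  shows "decidable_in A (\<lambda>n. f n = (g n :: nat))"
  unfolding eq_iff by (intro comp_intro assms)

lemma computable_in_sum [comp_intro]: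
  assumes "computable_in A b" "computable_in A (\<lambda>z. f (pfst z) (psnd z))"
  shows "computable_in A (\<lambda>n. \<Sum>i<b n. f n i)"
proof -
  have eq: "rec_nat 0 (\<lambda>i r. r + f n i) k = (\<Sum>i<k. f n i)" for n k by (induction k) auto
  have "computable_in A (\<lambda>z. f (pfst z) (pfst (psnd z)))"
    using computable_in_compose[OF assms(2), of "\<lambda>z. pair (pfst z) (pfst (psnd z))"]
    by (simp add: comp_intro)
  then have "computable_in A (\<lambda>n. rec_nat 0 (\<lambda>i r. r + f n i) (b n))"
    by (intro comp_intro assms)
  then show ?thesis by (simp only: eq)
qed

lemma decidable_in_all_less [comp_intro]:
  assumes "computable_in A b" "decidable_in A (\<lambda>z. P (pfst z) (psnd z))"
  shows "decidable_in A (\<lambda>n. \<forall>i<b n. P n i)"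
proof -
  have "decidable_in A (\<lambda>n. (\<Sum>i<b n. of_bool (\<not> P n i)) = (0::nat))"
    by (intro comp_intro assms)
  moreover have "(\<Sum>i<b n. of_bool (\<not> P n i)) = (0::nat) \<longleftrightarrow> (\<forall>i<b n. P n i)" for n
    by (simp only: sum_eq_0_iff finite_lessThan) auto
  ultimately show ?thesis by simp
qed

lemma decidable_in_ex_less [comp_intro]:
  assumes "computable_in A b" "decidable_in A (\<lambda>z. P (pfst z) (psnd z))"
  shows "decidable_in A (\<lambda>n. \<exists>i<b n. P n i)"
proof -
  have "decidable_in A (\<lambda>n. \<not> (\<forall>i<b n. \<not> P n i))"
    by (intro comp_intro assms)
  then show ?thesis by simp
qed

text \<open>\<open>PMin\<close> searches for a zero, so \<open>p\<close> has to decide the negation;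
  since \<open>p\<close> is total, no undefined earlier value can block the search.\<close>

lemma run_PMin_decidable:
  assumes p: "\<And>z. run A p z = Some (of_bool (\<not> P (pfst z) (psnd z)))"
  shows "run A (PMin p) n = (if \<exists>k. P n k then Some (LEAST k. P n k) else None)"
proof (cases "\<exists>k. P n k")
  case True
  define m where "m = (LEAST k. P n k)"
  have m: "P n m" "\<And>k. P n k \<Longrightarrow> m \<le> k"
    using True unfolding m_def by (auto intro: LeastI_ex Least_le)
  have "(run A p (pair n k) = Some 0 \<and> (\<forall>j<k. \<exists>v>0. run A p (pair n j) = Some v)) \<longleftrightarrow> k = m" for k
    using m by (auto simp: p) (metis leD m(2) antisym_conv3 m(1))+
  moreover have "\<exists>k. k = m" "(LEAST k. k = m) = m"
    by (auto intro: Least_equality)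
  ultimately show ?thesis using True by (simp add: Let_def m_def[symmetric])
next
  case False
  then show ?thesis by (simp add: p)
qed

lemma computable_in_Least [comp_intro]:
  assumes "decidable_in A (\<lambda>z. P (pfst z) (psnd z))" "\<And>n. \<exists>k. P n k"
  shows "computable_in A (\<lambda>n. LEAST k. P n k)"
proof -
  obtain p where "\<And>z. run A p z = Some (of_bool (\<not> P (pfst z) (psnd z)))"
    using decidable_in_not[OF assms(1)] unfolding decidable_in_def computable_in_def by blast
  then show ?thesis
    unfolding computable_in_def using assms(2) run_PMin_decidable[of A p P] by (intro exI[of _ "PMin p"]) simp
qed

lemma computable_in_div [comp_intro]:
  assumes "computable_in A f" "computable_in A g"
  shows "computable_in A (\<lambda>n. f n div g n)"
proof -
  \<comment> \<open>The disjunct \<open>b = 0\<close> keeps the search total and yields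
    \<open>0\<close>, the value of division by zero.\<close>
  have eq: "(LEAST k. b = 0 \<or> a < Suc k * b) = a div b" for a b :: nat
  proof (cases "b = 0")
    case False
    then show ?thesis
      by (intro Least_equality) (auto simp: dividend_less_div_times less_mult_imp_div_less less_Suc_eq_le[symmetric])
  qed simp
  have "computable_in A (\<lambda>n. LEAST k. g n = 0 \<or> f n < Suc k * g n)"
  proof (intro comp_intro assms[THEN computable_in_compose])
    show "\<exists>k. g n = 0 \<or> f n < Suc k * g n" for n
      by (metis dividend_less_div_times mult.commute mult_Suc gr0I)
  qed
  then show ?thesis by (simp only: eq)
qed

lemma computable_in_mod [comp_intro]:
  assumes "computable_in A f" "computable_in A g"
  shows "computable_in A (\<lambda>n. f n mod g n)"
  unfolding minus_div_mult_eq_mod[symmetric] by (intro comp_intro assms)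

lemma decidable_in_set_decode [comp_intro]:
  assumes "computable_in A f" "computable_in A g"
  shows "decidable_in A (\<lambda>n. f n \<in> set_decode (g n))"
  unfolding set_decode_def mem_Collect_eq odd_iff_mod_2_eq_one
  by (intro comp_intro assms)

section \<open>A universal machine\<close>

text \<open>
  A configuration either evaluates a program code on an argument or returns a value, in both
  cases to a stack of frames; a frame carries a tag and the data of the suspended computation.
\<close>

definition frame :: "nat \<Rightarrow> nat \<Rightarrow> nat \<Rightarrow> nat" where
  "frame t d K = Suc (pair (pair t d) K)"

definition eval_conf :: "nat \<Rightarrow> nat \<Rightarrow> nat \<Rightarrow> nat" where
  "eval_conf e n K = pair 0 (pair (pair e n) K)"

definition return_conf :: "nat \<Rightarrow> nat \<Rightarrow> nat" where
  "return_conf v K = pair 1 (pair v K)"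

definition eval_step :: "nat \<Rightarrow> nat \<Rightarrow> nat \<Rightarrow> nat \<Rightarrow> nat" where
  "eval_step t d n K =
    (if t = 0 then return_conf 0 K
     else if t = 1 then return_conf (Suc n) K
     else if t = 2 then return_conf (pfst n) K
     else if t = 3 then return_conf (psnd n) K
     else if t = 4 then return_conf 0 K
     else if t = 5 then eval_conf (pfst d) n (frame 0 (pair (psnd d) n) K)
     else if t = 6 then eval_conf (psnd d) n (frame 2 (pfst d) K)
     else if t = 7 then eval_conf (pfst d) (pfst n)
       (frame 3 (pair (pair (psnd d) (pfst n)) (pair 0 (psnd n))) K)
     else eval_conf d (pair n 0) (frame 4 (pair (pair d n) 0) K))"

text \<open>Frames \<open>0\<close> and \<open>1\<close> wait for the first and the second component
  of a pair, frame \<open>2\<close> for the inner value of a composition. Frame \<open>3\<close>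
  holds step program, parameter, counter and bound of a recursion; the remaining tags hold program,
  argument and current candidate of a minimisation.\<close>

definition return_step :: "nat \<Rightarrow> nat \<Rightarrow> nat \<Rightarrow> nat \<Rightarrow> nat" where
  "return_step t d v K =
    (if t = 0 then eval_conf (pfst d) (psnd d) (frame 1 v K)
     else if t = 1 then return_conf (pair d v) K
     else if t = 2 then eval_conf d v K
     else if t = 3 then
       (if pfst (psnd d) = psnd (psnd d) then return_conf v K
        else eval_conf (pfst (pfst d)) (pair (psnd (pfst d)) (pair (pfst (psnd d)) v))
          (frame 3 (pair (pfst d) (pair (Suc (pfst (psnd d))) (psnd (psnd d)))) K))
     else
       (if v = 0 then return_conf (psnd d) K
        else eval_conf (pfst (pfst d)) (pair (psnd (pfst d)) (Suc (psnd d)))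
          (frame 4 (pair (pfst d) (Suc (psnd d))) K)))"

text \<open>The \<open>- 1\<close> undoes the \<open>Suc\<close> in \<open>frame\<close>, which
  reserves \<open>0\<close> for the empty stack. A return to the empty stack is a fixed point, so
  halting persists.\<close>

definition mstep :: "nat \<Rightarrow> nat" where
  "mstep q =
    (if pfst q = 0 then
       eval_step (pfst (pfst (pfst (psnd q)))) (psnd (pfst (pfst (psnd q))))
         (psnd (pfst (psnd q))) (psnd (psnd q))
     else if psnd (psnd q) = 0 then q
     else return_step (pfst (pfst (psnd (psnd q) - 1))) (psnd (pfst (psnd (psnd q) - 1)))
       (pfst (psnd q)) (psnd (psnd (psnd q) - 1)))"

definition msteps :: "nat \<Rightarrow> nat \<Rightarrow> nat" where
  "msteps t q = rec_nat q (\<lambda>i. mstep) t"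

definition halted :: "nat \<Rightarrow> bool" where
  "halted q \<longleftrightarrow> pfst q \<noteq> 0 \<and> psnd (psnd q) = 0"

definition halts_within :: "nat \<Rightarrow> nat \<Rightarrow> nat \<Rightarrow> bool" where
  "halts_within e n t \<longleftrightarrow> halted (msteps t (eval_conf e n 0))"

lemma computable_in_frame [comp_intro]:
  assumes "computable_in A t" "computable_in A d" "computable_in A K"
  shows "computable_in A (\<lambda>x. frame (t x) (d x) (K x))"
  unfolding frame_def by (intro comp_intro assms)

lemma computable_in_eval_conf [comp_intro]:
  assumes "computable_in A e" "computable_in A n" "computable_in A K"
  shows "computable_in A (\<lambda>x. eval_conf (e x) (n x) (K x))"
  unfolding eval_conf_def by (intro comp_intro assms)

lemma computable_in_return_conf [comp_intro]:
  assumes "computable_in A v" "computable_in A K"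
  shows "computable_in A (\<lambda>x. return_conf (v x) (K x))"
  unfolding return_conf_def by (intro comp_intro assms)

lemma computable_in_eval_step [comp_intro]:
  assumes "computable_in A t" "computable_in A d" "computable_in A n" "computable_in A K"
  shows "computable_in A (\<lambda>x. eval_step (t x) (d x) (n x) (K x))"
  unfolding eval_step_def by (intro comp_intro assms)

lemma computable_in_return_step [comp_intro]:
  assumes "computable_in A t" "computable_in A d" "computable_in A v" "computable_in A K"
  shows "computable_in A (\<lambda>x. return_step (t x) (d x) (v x) (K x))"
  unfolding return_step_def by (intro comp_intro assms)

lemma computable_in_mstep: "computable_in A mstep"
  unfolding mstep_def by (intro comp_intro)

lemma decidable_in_halts_within [comp_intro]:
  assumes "computable_in A e" "computable_in A n" "computable_in A t"
  shows "decidable_in A (\<lambda>x. halts_within (e x) (n x) (t x))"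
  unfolding halts_within_def halted_def msteps_def
  by (intro comp_intro assms computable_in_mstep[THEN computable_in_compose])

lemma msteps_0 [simp]: "msteps 0 q = q"
  and msteps_Suc: "msteps (Suc t) q = mstep (msteps t q)"
  by (simp_all add: msteps_def)

lemma msteps_add: "msteps (s + t) q = msteps s (msteps t q)"
  by (induction s) (simp_all add: msteps_Suc)

lemma halted_msteps: "halted q \<Longrightarrow> halted (msteps t q)"
  by (induction t) (auto simp: msteps_Suc mstep_def halted_def)

lemma halts_within_mono: "halts_within e n s \<Longrightarrow> s \<le> t \<Longrightarrow> halts_within e n t"
  unfolding halts_within_def
  using halted_msteps[of "msteps s (eval_conf e n 0)" "t - s"] by (simp flip: msteps_add)

section \<open>Agreement of the machine with the semantics of programs\<close>

definition reaches :: "nat \<Rightarrow> nat \<Rightarrow> bool" where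
  "reaches q r \<longleftrightarrow> (\<exists>t. msteps t q = r)"

definition diverges :: "nat \<Rightarrow> bool" where
  "diverges q \<longleftrightarrow> (\<forall>t. \<not> halted (msteps t q))"

lemma reaches_refl: "reaches q q"
  unfolding reaches_def by (rule exI[of _ 0]) simp

lemma reaches_trans: "reaches q r \<Longrightarrow> reaches r u \<Longrightarrow> reaches q u"
  unfolding reaches_def by (metis msteps_add)

lemma reaches_mstep: "reaches q (mstep q)"
  unfolding reaches_def by (rule exI[of _ 1]) (simp add: msteps_Suc)

lemma diverges_reaches:
  assumes "reaches q r" "diverges r"
  shows "diverges q"
  unfolding diverges_def
proof (intro allI notI)
  fix t assume t: "halted (msteps t q)"
  obtain s where "msteps s q = r"
    using assms(1) unfolding reaches_def by blast
  then have "halted (msteps t r)"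
    using halted_msteps[OF t, of s] by (metis msteps_add add.commute)
  with assms(2) show False
    unfolding diverges_def by blast
qed

lemma mstep_eval_conf [simp]:
  "mstep (eval_conf 0 n K) = return_conf 0 K"
  "mstep (eval_conf (pair (Suc 0) 0) n K) = return_conf (Suc n) K"
  "mstep (eval_conf (pair 2 0) n K) = return_conf (pfst n) K"
  "mstep (eval_conf (pair 3 0) n K) = return_conf (psnd n) K"
  "mstep (eval_conf (pair 4 0) n K) = return_conf 0 K"
  "mstep (eval_conf (pair 5 (pair d e)) n K) = eval_conf d n (frame 0 (pair e n) K)"
  "mstep (eval_conf (pair 6 (pair d e)) n K) = eval_conf e n (frame 2 d K)"
  "mstep (eval_conf (pair 7 (pair d e)) n K) =
     eval_conf d (pfst n) (frame 3 (pair (pair e (pfst n)) (pair 0 (psnd n))) K)"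
  "mstep (eval_conf (pair 8 d) n K) = eval_conf d (pair n 0) (frame 4 (pair (pair d n) 0) K)"
  by (simp_all add: mstep_def eval_conf_def eval_step_def)

lemma mstep_return_conf [simp]:
  "mstep (return_conf v (frame 0 (pair e n) K)) = eval_conf e n (frame 1 v K)"
  "mstep (return_conf v (frame (Suc 0) w K)) = return_conf (pair w v) K"
  "mstep (return_conf v (frame 2 e K)) = eval_conf e v K"
  "mstep (return_conf v (frame 3 (pair (pair e a) (pair i k)) K)) =
     (if i = k then return_conf v K
      else eval_conf e (pair a (pair i v)) (frame 3 (pair (pair e a) (pair (Suc i) k)) K))"
  "mstep (return_conf v (frame 4 (pair (pair e n) k) K)) =
     (if v = 0 then return_conf k K
      else eval_conf e (pair n (Suc k)) (frame 4 (pair (pair e n) (Suc k)) K))"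
  by (simp_all add: mstep_def return_conf_def return_step_def frame_def)

text \<open>The stack is arbitrary because subprograms run on top of the frames of their callers.
  For the same reason the clause for \<open>None\<close> concerns the whole computation: an
  undefined subprogram must keep its callers from halting.\<close>

definition simulates :: "prog \<Rightarrow> bool" where
  "simulates p \<longleftrightarrow> (\<forall>n K.
     (case run no_oracle p n of
        Some v \<Rightarrow> reaches (eval_conf (goedel p) n K) (return_conf v K)
      | None \<Rightarrow> diverges (eval_conf (goedel p) n K)))"

lemma simulatesD:
  assumes "simulates p"
  shows "run no_oracle p n = Some v \<Longrightarrow> reaches (eval_conf (goedel p) n K) (return_conf v K)"
    and "run no_oracle p n = None \<Longrightarrow> diverges (eval_conf (goedel p) n K)"
  using assms unfolding simulates_def by (metis option.case)+

lemma simulatesI: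
  assumes "\<And>n K v. run no_oracle p n = Some v \<Longrightarrow> reaches (mstep (eval_conf (goedel p) n K)) (return_conf v K)"
    and "\<And>n K. run no_oracle p n = None \<Longrightarrow> diverges (mstep (eval_conf (goedel p) n K))"
  shows "simulates p"
  unfolding simulates_def
  using assms reaches_trans[OF reaches_mstep] diverges_reaches[OF reaches_mstep]
  by (auto split: option.split)

lemma reaches_stepI: "reaches q r \<Longrightarrow> reaches (mstep r) u \<Longrightarrow> reaches q u"
  by (meson reaches_trans reaches_mstep)

lemma diverges_stepI: "reaches q r \<Longrightarrow> diverges (mstep r) \<Longrightarrow> diverges q"
  by (meson reaches_mstep diverges_reaches)

lemma simulates_PPair:
  assumes f: "simulates f" and g: "simulates g"
  shows "simulates (PPair f g)"
proof (rule simulatesI)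
  fix n K v assume "run no_oracle (PPair f g) n = Some v"
  then obtain x y where xy: "run no_oracle f n = Some x" "run no_oracle g n = Some y" "v = pair x y"
    by (auto simp: bind_eq_Some_conv)
  show "reaches (mstep (eval_conf (goedel (PPair f g)) n K)) (return_conf v K)"
    using xy
    by (auto intro!: reaches_refl reaches_stepI[OF simulatesD(1)[OF f]] reaches_stepI[OF simulatesD(1)[OF g]])
next
  fix n K assume none: "run no_oracle (PPair f g) n = None"
  show "diverges (mstep (eval_conf (goedel (PPair f g)) n K))"
  proof (cases "run no_oracle f n")
    case None
    then show ?thesis by (simp add: simulatesD(2)[OF f])
  next
    case (Some x)
    with none have "run no_oracle g n = None"
      by (cases "run no_oracle g n") auto
    then show ?thesis
      using diverges_stepI[OF simulatesD(1)[OF f Some]] by (simp add: simulatesD(2)[OF g])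
  qed
qed

lemma simulates_PComp:
  assumes f: "simulates f" and g: "simulates g"
  shows "simulates (PComp f g)"
proof (rule simulatesI)
  fix n K v assume "run no_oracle (PComp f g) n = Some v"
  then obtain x where x: "run no_oracle g n = Some x" "run no_oracle f x = Some v"
    by (auto simp: bind_eq_Some_conv)
  show "reaches (mstep (eval_conf (goedel (PComp f g)) n K)) (return_conf v K)"
    using reaches_stepI[OF simulatesD(1)[OF g x(1)]] simulatesD(1)[OF f x(2)] by simp
next
  fix n K assume none: "run no_oracle (PComp f g) n = None"
  show "diverges (mstep (eval_conf (goedel (PComp f g)) n K))"
  proof (cases "run no_oracle g n")
    case None
    then show ?thesis by (simp add: simulatesD(2)[OF g])
  next
    case (Some x)
    with none have "run no_oracle f x = None" by simp
    then show ?thesis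
      using diverges_stepI[OF simulatesD(1)[OF g Some]] by (simp add: simulatesD(2)[OF f])
  qed
qed

lemma simulates_PRec:
  assumes f: "simulates f" and g: "simulates g"
  shows "simulates (PRec f g)"
proof -
  define R where "R a k = rec_nat (run no_oracle f a)
    (\<lambda>i r. Option.bind r (\<lambda>v. run no_oracle g (pair a (pair i v)))) k" for a k
  have run: "run no_oracle (PRec f g) n = R (pfst n) (psnd n)" for n
    by (simp add: R_def split_beta pfst_def psnd_def)
  have "(\<forall>v. R a i = Some v \<longrightarrow>
       reaches (eval_conf (goedel f) a (frame 3 (pair (pair (goedel g) a) (pair 0 k)) K))
         (return_conf v (frame 3 (pair (pair (goedel g) a) (pair i k)) K))) \<and>
     (R a i = None \<longrightarrow>
       diverges (eval_conf (goedel f) a (frame 3 (pair (pair (goedel g) a) (pair 0 k)) K)))"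
    if "i \<le> k" for a i k K
    using that
  proof (induction i)
    case 0
    show ?case using simulatesD[OF f] by (simp add: R_def)
  next
    case (Suc i)
    then have IH: "\<And>v. R a i = Some v \<Longrightarrow>
       reaches (eval_conf (goedel f) a (frame 3 (pair (pair (goedel g) a) (pair 0 k)) K))
         (return_conf v (frame 3 (pair (pair (goedel g) a) (pair i k)) K))"
      "R a i = None \<Longrightarrow>
       diverges (eval_conf (goedel f) a (frame 3 (pair (pair (goedel g) a) (pair 0 k)) K))"
      and "i \<noteq> k"
      by auto
    show ?case
    proof (cases "R a i")
      case None
      then show ?thesis using IH(2) by (simp add: R_def)
    next
      case (Some v)
      then have "R a (Suc i) = run no_oracle g (pair a (pair i v))" by (simp add: R_def)
      then show ?thesis
        using reaches_stepI[OF IH(1)[OF Some]] diverges_stepI[OF IH(1)[OF Some]] \<open>i \<noteq> k\<close>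
          simulatesD[OF g] by simp
    qed
  qed
  note sim = this[OF order_refl]
  show ?thesis
  proof (rule simulatesI)
    fix n K v assume "run no_oracle (PRec f g) n = Some v"
    then show "reaches (mstep (eval_conf (goedel (PRec f g)) n K)) (return_conf v K)"
      using reaches_stepI[OF sim[THEN conjunct1, rule_format]] reaches_refl
      by (simp add: run del: run.simps)
  next
    fix n K assume "run no_oracle (PRec f g) n = None"
    then show "diverges (mstep (eval_conf (goedel (PRec f g)) n K))"
      using sim by (simp add: run del: run.simps)
  qed
qed

lemma simulates_PMin:
  assumes f: "simulates f"
  shows "simulates (PMin f)"
proof -
  define pos where "pos n k \<longleftrightarrow> (\<forall>j<k. \<exists>v>0. run no_oracle f (pair n j) = Some v)" for n k
  define q where "q n K k = eval_conf (goedel f) (pair n k) (frame 4 (pair (pair (goedel f) n) k) K)" for n K k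
  have start: "mstep (eval_conf (goedel (PMin f)) n K) = q n K 0" for n K
    by (simp add: q_def)
  \<comment> \<open>The bound \<open>t \<ge> k\<close> serves the case of an infinite search: the
    machine is then found evaluating at arbitrarily late times, so it never halted.\<close>
  have search: "\<exists>t\<ge>k. msteps t (q n K 0) = q n K k" if "pos n k" for n K k
    using that
  proof (induction k)
    case 0
    show ?case by (rule exI[of _ 0]) simp
  next
    case (Suc k)
    then obtain t where t: "t \<ge> k" "msteps t (q n K 0) = q n K k"
      unfolding pos_def by auto
    obtain v where v: "v > 0" "run no_oracle f (pair n k) = Some v"
      using Suc.prems unfolding pos_def by blast
    obtain u where "msteps u (q n K k) = return_conf v (frame 4 (pair (pair (goedel f) n) k) K)"
      using simulatesD(1)[OF f v(2)] unfolding q_def reaches_def by blast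
    with t v(1) have "msteps (Suc (u + t)) (q n K 0) = q n K (Suc k)"
      by (simp add: msteps_Suc msteps_add q_def)
    with t(1) show ?case by (intro exI[of _ "Suc (u + t)"]) simp
  qed
  then have reach: "reaches (q n K 0) (q n K k)" if "pos n k" for n K k
    using that unfolding reaches_def by blast
  have run: "run no_oracle (PMin f) n =
      (if \<exists>k. run no_oracle f (pair n k) = Some 0 \<and> pos n k
       then Some (LEAST k. run no_oracle f (pair n k) = Some 0 \<and> pos n k) else None)" for n
    by (simp add: pos_def Let_def)
  show ?thesis
  proof (rule simulatesI)
    fix n K v assume "run no_oracle (PMin f) n = Some v"
    then have ex: "\<exists>k. run no_oracle f (pair n k) = Some 0 \<and> pos n k"
      and v: "v = (LEAST k. run no_oracle f (pair n k) = Some 0 \<and> pos n k)"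
      by (auto simp: run simp del: run.simps split: if_splits)
    have "run no_oracle f (pair n v) = Some 0 \<and> pos n v"
      unfolding v by (rule LeastI_ex[OF ex])
    then have "reaches (q n K 0) (return_conf 0 (frame 4 (pair (pair (goedel f) n) v) K))"
      using reaches_trans[OF reach] simulatesD(1)[OF f] unfolding q_def by blast
    then show "reaches (mstep (eval_conf (goedel (PMin f)) n K)) (return_conf v K)"
      unfolding start by (rule reaches_stepI) (simp add: reaches_refl)
  next
    fix n K assume "run no_oracle (PMin f) n = None"
    then have none: "\<not> (run no_oracle f (pair n k) = Some 0 \<and> pos n k)" for k
      by (auto simp: run simp del: run.simps split: if_splits)
    show "diverges (mstep (eval_conf (goedel (PMin f)) n K))"
    proof (cases "\<forall>k. pos n k")
      case True
      show ?thesis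
        unfolding start diverges_def
      proof (intro allI notI)
        fix t assume halt: "halted (msteps t (q n K 0))"
        obtain u where u: "u \<ge> t" "msteps u (q n K 0) = q n K t"
          using search True by blast
        have "msteps (u - t) (msteps t (q n K 0)) = q n K t"
          using u by (simp flip: msteps_add)
        then have "halted (q n K t)" using halted_msteps[OF halt] by metis
        then show False by (simp add: halted_def q_def eval_conf_def)
      qed
    next
      case False
      \<comment> \<open>The first argument without a positive value. Its value is not
        \<open>0\<close>, or else the search would have succeeded, so it is undefined.\<close>
      define m where "m = (LEAST k. \<not> pos n (Suc k))"
      have "\<exists>k. \<not> pos n (Suc k)"
        using False unfolding pos_def by (metis less_Suc_eq)
      then have m: "\<not> pos n (Suc m)" "\<And>k. k < m \<Longrightarrow> pos n (Suc k)"
        unfolding m_def by (rule LeastI_ex) (use not_less_Least in blast)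
      then have "pos n m" unfolding pos_def by blast
      with m(1) none[of m] have "run no_oracle f (pair n m) = None"
        unfolding pos_def by (metis bot_nat_0.not_eq_extremum less_Suc_eq option.exhaust)
      then show ?thesis
        unfolding start using diverges_reaches[OF reach[OF \<open>pos n m\<close>]] simulatesD(2)[OF f]
        unfolding q_def by blast
    qed
  qed
qed

lemma simulates: "simulates p"
proof (induction p)
  case (PPair f g)
  then show ?case by (rule simulates_PPair)
next
  case (PComp f g)
  then show ?case by (rule simulates_PComp)
next
  case (PRec f g)
  then show ?case by (rule simulates_PRec)
next
  case (PMin f)
  then show ?case by (rule simulates_PMin)
qed (rule simulatesI; simp add: reaches_refl pfst_def psnd_def)+

lemma halts_within_goedel_iff:
  "(\<exists>t. halts_within (goedel p) n t) \<longleftrightarrow> run no_oracle p n \<noteq> None"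
proof (cases "run no_oracle p n")
  case None
  then show ?thesis
    using simulatesD(2)[OF simulates None, of 0] by (simp add: halts_within_def diverges_def)
next
  case (Some v)
  then obtain t where "msteps t (eval_conf (goedel p) n 0) = return_conf v 0"
    using simulatesD(1)[OF simulates Some, of 0] unfolding reaches_def by blast
  then have "halts_within (goedel p) n t"
    by (simp add: halts_within_def halted_def return_conf_def)
  with Some show ?thesis by auto
qed

section \<open>Coded strings, arrays and initial segments\<close>

text \<open>A list \<open>x # xs\<close> has the code \<open>Suc (pair x y)\<close> with
  \<open>y\<close> the code of \<open>xs\<close>; hence the \<open>- 1\<close>. The code
  \<open>0\<close> of the empty list is fixed, so dropping too much is harmless.\<close>

definition cdrop :: "nat \<Rightarrow> nat \<Rightarrow> nat" where
  "cdrop i m = rec_nat m (\<lambda>_ r. psnd (r - 1)) i"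

definition cnth :: "nat \<Rightarrow> nat \<Rightarrow> nat" where
  "cnth m i = pfst (cdrop i m - 1)"

definition clen :: "nat \<Rightarrow> nat" where
  "clen m = (LEAST i. cdrop i m = 0)"

definition csnoc :: "nat \<Rightarrow> nat \<Rightarrow> nat" where
  "csnoc m x = rec_nat (Suc (pair x 0)) (\<lambda>i r. Suc (pair (cnth m (clen m - Suc i)) r)) (clen m)"

definition cprefix :: "nat \<Rightarrow> nat \<Rightarrow> bool" where
  "cprefix m u \<longleftrightarrow> clen m \<le> clen u \<and> (\<forall>i<clen m. cnth m i = cnth u i)"

definition cstring :: "nat \<Rightarrow> bool" where
  "cstring m \<longleftrightarrow> (\<forall>i<clen m. cnth m i \<le> 1)"

lemma list_encode_eq_0_iff [simp]: "list_encode xs = 0 \<longleftrightarrow> xs = []"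
  by (cases xs) auto

lemma cdrop_list_encode [simp]: "cdrop i (list_encode xs) = list_encode (drop i xs)"
proof (induction i)
  case (Suc i)
  have "psnd (list_encode ys - 1) = list_encode (tl ys)" for ys
    by (cases ys) auto
  with Suc show ?case by (simp add: cdrop_def drop_Suc tl_drop)
qed (simp add: cdrop_def)

lemma clen_list_encode [simp]: "clen (list_encode xs) = length xs"
  unfolding clen_def by (rule Least_equality) auto

lemma cnth_list_encode [simp]: "i < length xs \<Longrightarrow> cnth (list_encode xs) i = xs ! i"
  by (simp add: cnth_def Cons_nth_drop_Suc[symmetric])

lemma csnoc_list_encode [simp]: "csnoc (list_encode xs) x = list_encode (xs @ [x])"
proof -
  have "rec_nat (Suc (pair x 0)) (\<lambda>i r. Suc (pair (cnth (list_encode xs) (length xs - Suc i)) r)) i =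
      list_encode (drop (length xs - i) xs @ [x])" if "i \<le> length xs" for i
    using that
  proof (induction i)
    case (Suc i)
    then have "drop (length xs - Suc i) xs = xs ! (length xs - Suc i) # drop (length xs - i) xs"
      by (metis Cons_nth_drop_Suc Suc_diff_Suc Suc_le_lessD diff_less less_imp_le_nat
          list.size(3) not_less_zero length_greater_0_conv zero_less_Suc)
    with Suc show ?case by simp
  qed simp
  from this[of "length xs"] show ?thesis by (simp add: csnoc_def)
qed

lemma computable_in_cdrop:
  assumes "computable_in A f" "computable_in A g"
  shows "computable_in A (\<lambda>n. cdrop (f n) (g n))"
  unfolding cdrop_def by (intro comp_intro assms)

lemma computable_in_cnth [comp_intro]:
  assumes "computable_in A f" "computable_in A g"
  shows "computable_in A (\<lambda>n. cnth (f n) (g n))"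
  unfolding cnth_def by (intro comp_intro computable_in_cdrop assms)

lemma computable_in_clen [comp_intro]:
  assumes "computable_in A f"
  shows "computable_in A (\<lambda>n. clen (f n))"
  unfolding clen_def
proof (intro comp_intro computable_in_cdrop assms[THEN computable_in_compose])
  show "\<exists>i. cdrop i (f n) = 0" for n
    using cdrop_list_encode[of "length (list_decode (f n))" "list_decode (f n)"]
    by (intro exI[of _ "length (list_decode (f n))"]) simp
qed

lemma computable_in_csnoc [comp_intro]:
  assumes "computable_in A f" "computable_in A g"
  shows "computable_in A (\<lambda>n. csnoc (f n) (g n))"
  unfolding csnoc_def by (intro comp_intro assms[THEN computable_in_compose])

lemma decidable_in_cprefix [comp_intro]:
  assumes "computable_in A f" "computable_in A g"
  shows "decidable_in A (\<lambda>n. cprefix (f n) (g n))"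
  unfolding cprefix_def by (intro comp_intro assms[THEN computable_in_compose])

lemma decidable_in_cstring [comp_intro]:
  assumes "computable_in A f"
  shows "decidable_in A (\<lambda>n. cstring (f n))"
  unfolding cstring_def by (intro comp_intro assms[THEN computable_in_compose])

lemma clen_str_encode [simp]: "clen (str_encode \<sigma>) = length \<sigma>"
  by (simp add: str_encode_def)

lemma cnth_str_encode [simp]: "i < length \<sigma> \<Longrightarrow> cnth (str_encode \<sigma>) i = of_bool (\<sigma> ! i)"
  by (simp add: str_encode_def)

lemma csnoc_str_encode [simp]: "csnoc (str_encode \<sigma>) 0 = str_encode (\<sigma> @ [False])"
  by (simp add: str_encode_def)

lemma str_encode_Nil [simp]: "str_encode [] = 0"
  by (simp add: str_encode_def)

lemma str_encode_eq_iff [simp]: "str_encode \<sigma> = str_encode \<tau> \<longleftrightarrow> \<sigma> = \<tau>"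
proof -
  have "inj (of_bool :: bool \<Rightarrow> nat)"
    by (rule injI) (simp add: of_bool_def split: if_splits)
  then show ?thesis
    by (simp add: str_encode_def list_encode_eq inj_map_eq_map)
qed

lemma cstring_iff: "cstring m \<longleftrightarrow> (\<exists>\<tau>. m = str_encode \<tau>)"
proof
  assume "cstring m"
  define xs where "xs = list_decode m"
  have m: "m = list_encode xs" by (simp add: xs_def)
  have "\<forall>x\<in>set xs. x \<le> 1"
    using \<open>cstring m\<close> unfolding m cstring_def by (auto simp: in_set_conv_nth)
  then have "map of_bool (map (\<lambda>x. x = 1) xs) = xs"
    unfolding map_map by (intro map_idI) (auto simp: le_Suc_eq)
  then show "\<exists>\<tau>. m = str_encode \<tau>"
    unfolding m str_encode_def by metis
qed (auto simp: cstring_def)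

lemma cprefix_iff: "cprefix m u \<longleftrightarrow> prefix (list_decode m) (list_decode u)"
proof -
  have "cprefix (list_encode xs) (list_encode ys) \<longleftrightarrow> prefix xs ys" for xs ys
  proof
    assume *: "cprefix (list_encode xs) (list_encode ys)"
    then have "length xs \<le> length ys" by (simp add: cprefix_def)
    with * have "take (length xs) ys = xs"
      by (intro nth_equalityI) (auto simp: cprefix_def)
    then show "prefix xs ys" by (metis take_is_prefix)
  qed (auto simp: cprefix_def prefix_def nth_append)
  from this[of "list_decode m" "list_decode u"] show ?thesis by simp
qed

lemma cprefix_str_encode [simp]: "cprefix (str_encode \<sigma>) (str_encode \<tau>) \<longleftrightarrow> prefix \<sigma> \<tau>"
proof
  assume "cprefix (str_encode \<sigma>) (str_encode \<tau>)"
  then have "str_encode (take (length \<sigma>) \<tau>) = str_encode \<sigma>"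
    by (auto simp: cprefix_iff str_encode_def prefix_def simp flip: take_map)
  then show "prefix \<sigma> \<tau>" by (metis str_encode_eq_iff take_is_prefix)
qed (simp add: cprefix_iff str_encode_def map_mono_prefix)

text \<open>
  The array coded by a number is the sequence of first components along its iterated second
  components; the code \<open>0\<close> is thus the array that is constantly \<open>0\<close>.
\<close>

definition adrop :: "nat \<Rightarrow> nat \<Rightarrow> nat" where
  "adrop i a = rec_nat a (\<lambda>_. psnd) i"

definition lookup :: "nat \<Rightarrow> nat \<Rightarrow> nat" where
  "lookup a i = pfst (adrop i a)"

definition update :: "nat \<Rightarrow> nat \<Rightarrow> nat \<Rightarrow> nat" where
  "update a j v = rec_nat (pair v (adrop (Suc j) a)) (\<lambda>i r. pair (lookup a (j - Suc i)) r) j"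

lemma adrop_add: "adrop i (adrop j a) = adrop (i + j) a"
  by (induction i) (simp_all add: adrop_def)

lemma lookup_0 [simp]: "lookup 0 i = 0"
proof -
  have "adrop i 0 = 0" by (induction i) (simp_all add: adrop_def)
  then show ?thesis by (simp add: lookup_def)
qed

lemma lookup_pair: "lookup (pair x r) i = (case i of 0 \<Rightarrow> x | Suc k \<Rightarrow> lookup r k)"
proof (cases i)
  case (Suc k)
  have "adrop 1 (pair x r) = r" by (simp add: adrop_def)
  then have "adrop (Suc k) (pair x r) = adrop k r"
    using adrop_add[of k 1 "pair x r"] by simp
  with Suc show ?thesis by (simp add: lookup_def)
qed (simp add: lookup_def adrop_def)

lemma lookup_update [simp]: "lookup (update a j v) k = (if k = j then v else lookup a k)"
proof -
  have "lookup (rec_nat (pair v (adrop (Suc j) a)) (\<lambda>i r. pair (lookup a (j - Suc i)) r) i) k =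
      (if k = i then v else lookup a (j - i + k))" if "i \<le> j" for i k
    using that
  proof (induction i arbitrary: k)
    case 0
    show ?case
      by (simp add: lookup_pair split: nat.split) (simp add: lookup_def adrop_add add.commute)
  next
    case (Suc i)
    then have "j - Suc i + Suc m = j - i + m" for m by simp
    with Suc show ?case by (simp add: lookup_pair split: nat.split)
  qed
  from this[of j k] show ?thesis by (simp add: update_def)
qed

lemma computable_in_adrop:
  assumes "computable_in A f" "computable_in A g"
  shows "computable_in A (\<lambda>n. adrop (f n) (g n))"
  unfolding adrop_def by (intro comp_intro assms)

lemma computable_in_lookup [comp_intro]:
  assumes "computable_in A f" "computable_in A g"
  shows "computable_in A (\<lambda>n. lookup (f n) (g n))"
  unfolding lookup_def by (intro comp_intro computable_in_adrop assms)

lemma computable_in_update [comp_intro]: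
  assumes "computable_in A f" "computable_in A g" "computable_in A h"
  shows "computable_in A (\<lambda>n. update (f n) (g n) (h n))"
  unfolding update_def
  by (intro comp_intro computable_in_adrop assms[THEN computable_in_compose])

section \<open>Finite oracles coded by numbers\<close>

definition initial :: "cantor \<Rightarrow> nat \<Rightarrow> nat" where
  "initial X s = set_encode {k. k < s \<and> X k}"

text \<open>Reads a number as an oracle that is \<open>False\<close> from some point on. This turns
  the oracle of the construction into an argument, as computability without oracle requires. The
  number \<open>initial X s\<close> does not record \<open>s\<close>, which is therefore passed
  along separately.\<close>

definition bits :: "nat \<Rightarrow> cantor" where
  "bits i = (\<lambda>k. k \<in> set_decode i)"

lemma bits_initial: "bits (initial X s) k \<longleftrightarrow> k < s \<and> X k"
  by (simp add: bits_def initial_def)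

lemma initial_bits: "i < 2 ^ s \<Longrightarrow> initial (bits i) s = i"
proof -
  assume "i < 2 ^ s"
  have "k < s" if "k \<in> set_decode i" for k
  proof (rule ccontr)
    assume "\<not> k < s"
    then have "i < 2 ^ k"
      using \<open>i < 2 ^ s\<close> by (meson less_le_trans not_less one_le_numeral power_increasing)
    with that show False by (simp add: set_decode_def)
  qed
  then have "{k. k < s \<and> bits i k} = set_decode i"
    by (auto simp: bits_def)
  then show ?thesis by (simp add: initial_def)
qed

lemma initial_eq_sum: "initial X s = (\<Sum>k<s. of_bool (X k) * 2 ^ k)"
proof -
  have "(\<Sum>k<s. of_bool (X k) * 2 ^ k) = (\<Sum>k\<in>{..<s} \<inter> {k. X k}. 2 ^ k :: nat)"
    by (simp add: sum.inter_restrict of_bool_def if_distrib[of "\<lambda>x. x * _"] cong: if_cong)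
  also have "{..<s} \<inter> {k. X k} = {k. k < s \<and> X k}" by auto
  finally show ?thesis by (simp add: initial_def set_encode_def)
qed

lemma initial_less: "initial X s < 2 ^ s"
proof -
  have "initial X s \<le> (\<Sum>k<s. 2 ^ k)"
    unfolding initial_eq_sum by (intro sum_mono) auto
  also have "\<dots> < (2::nat) ^ s"
    using sum_power2[of s] by (simp add: atLeast0LessThan)
  finally show ?thesis .
qed

lemma computable_in_initial [comp_intro]:
  assumes "computable_in A f"
  shows "computable_in A (\<lambda>n. initial A (f n))"
  unfolding initial_eq_sum by (intro comp_intro assms)

lemma decidable_in_bits [comp_intro]:
  assumes "computable_in A f" "computable_in A g"
  shows "decidable_in A (\<lambda>n. bits (f n) (g n))"
  unfolding bits_def by (intro comp_intro assms)

definition cbits :: "nat \<Rightarrow> nat" where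
  "cbits m = (\<Sum>i<clen m. cnth m i * 2 ^ i)"

lemma computable_in_cbits [comp_intro]:
  assumes "computable_in A f"
  shows "computable_in A (\<lambda>n. cbits (f n))"
  unfolding cbits_def by (intro comp_intro assms[THEN computable_in_compose])

section \<open>The fireworks construction\<close>

definition fires_within :: "nat \<Rightarrow> nat \<Rightarrow> nat \<Rightarrow> bool" where
  "fires_within j m s \<longleftrightarrow> (\<exists>u<s. cstring u \<and> cprefix m u \<and> halts_within j u s)"

definition fires :: "nat \<Rightarrow> nat \<Rightarrow> bool" where
  "fires j m \<longleftrightarrow> (\<exists>s. fires_within j m s)"

text \<open>The alternative \<open>s \<le> u\<close> makes the search total; under
  \<open>fires_within j m s\<close> it is never the reason for stopping.\<close>

definition spark :: "nat \<Rightarrow> nat \<Rightarrow> nat \<Rightarrow> nat" where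
  "spark j m s = (LEAST u. s \<le> u \<or> cstring u \<and> cprefix m u \<and> halts_within j u s)"

definition state :: "nat \<Rightarrow> nat \<Rightarrow> nat \<Rightarrow> nat \<Rightarrow> nat" where
  "state m t a r = pair (pair m t) (pair a r)"

definition str_of :: "nat \<Rightarrow> nat" where "str_of q = pfst (pfst q)"
definition time_of :: "nat \<Rightarrow> nat" where "time_of q = psnd (pfst q)"
definition active_of :: "nat \<Rightarrow> nat" where "active_of q = pfst (psnd q)"
definition array_of :: "nat \<Rightarrow> nat" where "array_of q = psnd (psnd q)"

definition refutations :: "nat \<Rightarrow> nat \<Rightarrow> nat" where
  "refutations q j = pfst (lookup (array_of q) j)"

definition guess :: "nat \<Rightarrow> nat \<Rightarrow> nat" where
  "guess q j = pfst (psnd (lookup (array_of q) j))"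

definition status :: "nat \<Rightarrow> nat \<Rightarrow> nat" where
  "status q j = psnd (psnd (lookup (array_of q) j))"

definition set_entry :: "nat \<Rightarrow> nat \<Rightarrow> nat \<Rightarrow> nat \<Rightarrow> nat \<Rightarrow> nat" where
  "set_entry q j k m x = update (array_of q) j (pair k (pair m x))"

text \<open>Block \<open>n\<close> lies between \<open>(n + 2) ^ 2\<close> and
  \<open>(n + 3) ^ 2\<close>, so distinct blocks are disjoint. Only the low bits of \<open>k\<close>
  count: exactly one \<open>k < 2 ^ (n + 2)\<close> is chosen.\<close>

definition chosen :: "cantor \<Rightarrow> nat \<Rightarrow> nat \<Rightarrow> bool" where
  "chosen X n k \<longleftrightarrow> (\<forall>i<n + 2. X ((n + 2) ^ 2 + i) \<longleftrightarrow> bits k i)"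

text \<open>
  The state consists of the current string, a clock for scheduling, \<open>Suc j\<close> if requirement \<open>j\<close>
  is waiting for an extension of the current string (and \<open>0\<close> otherwise), and for each
  requirement the number of its refuted guesses, the string it currently guesses not to be
  extendible into its set, and its status: \<open>0\<close> passive, \<open>1\<close> waiting, \<open>2\<close> satisfied.
  The block of \<open>n + 2\<close> random bits with \<open>n = pair c j\<close> determines after how many refutations
  requirement \<open>j\<close> stops guessing and starts to wait; it is not consulted before stage
  \<open>(n + 3)\<^sup>2\<close>, so that the state at stage \<open>s\<close> depends only on the first \<open>s\<close> bits.
\<close>

definition refuted :: "nat \<Rightarrow> nat \<Rightarrow> nat \<Rightarrow> nat \<Rightarrow> bool" where
  "refuted c s q j \<longleftrightarrow> status q j = 0 \<and> fires_within j (guess q j) s \<and> (pair c j + 3) ^ 2 \<le> s"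

text \<open>Every branch appends a bit, and both answers to a refutation concern this longer string:
  the waiting requirement seeks an extension of it, the retrying one guesses that there is none. The
  uniqueness argument rests on this coincidence.\<close>

definition passive_step :: "nat \<Rightarrow> cantor \<Rightarrow> nat \<Rightarrow> nat \<Rightarrow> nat \<Rightarrow> nat" where
  "passive_step c X s q j =
    (if \<not> refuted c s q j then state (csnoc (str_of q) 0) (Suc (time_of q)) 0 (array_of q)
     else if chosen X (pair c j) (refutations q j) then
       state (csnoc (str_of q) 0) (Suc (time_of q)) (Suc j) (set_entry q j (refutations q j) (guess q j) 1)
     else state (csnoc (str_of q) 0) (Suc (time_of q)) 0
       (set_entry q j (Suc (refutations q j)) (csnoc (str_of q) 0) 0))"

definition active_step :: "nat \<Rightarrow> nat \<Rightarrow> nat \<Rightarrow> nat" where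
  "active_step s q j =
    (if fires_within j (str_of q) s then
       state (spark j (str_of q) s) (time_of q) 0 (set_entry q j (refutations q j) (guess q j) 2)
     else q)"

text \<open>The clock value \<open>t\<close> gives the turn to \<open>pfst t\<close>, so each
  requirement owns infinitely many clock values. The clock stands still during a wait, so that no
  turn is lost.\<close>

definition stage_step :: "nat \<Rightarrow> cantor \<Rightarrow> nat \<Rightarrow> nat \<Rightarrow> nat" where
  "stage_step c X s q =
    (if active_of q = 0 then passive_step c X s q (pfst (time_of q))
     else active_step s q (active_of q - 1))"

definition stage :: "nat \<Rightarrow> cantor \<Rightarrow> nat \<Rightarrow> nat" where
  "stage c X s = rec_nat 0 (stage_step c X) s"

subsection \<open>Computability\<close>

lemma decidable_in_fires_within [comp_intro]:
  assumes "computable_in A j" "computable_in A m" "computable_in A s"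
  shows "decidable_in A (\<lambda>x. fires_within (j x) (m x) (s x))"
  unfolding fires_within_def by (intro comp_intro assms[THEN computable_in_compose])

lemma computable_in_spark [comp_intro]:
  assumes "computable_in A j" "computable_in A m" "computable_in A s"
  shows "computable_in A (\<lambda>x. spark (j x) (m x) (s x))"
  unfolding spark_def by (intro comp_intro assms[THEN computable_in_compose]) auto

lemma computable_in_state [comp_intro]:
  assumes "computable_in A m" "computable_in A t" "computable_in A a" "computable_in A r"
  shows "computable_in A (\<lambda>x. state (m x) (t x) (a x) (r x))"
  unfolding state_def by (intro comp_intro assms)

lemma computable_in_projections [comp_intro]:
  assumes "computable_in A q"
  shows "computable_in A (\<lambda>x. str_of (q x))" "computable_in A (\<lambda>x. time_of (q x))"
    "computable_in A (\<lambda>x. active_of (q x))" "computable_in A (\<lambda>x. array_of (q x))"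
  unfolding str_of_def time_of_def active_of_def array_of_def by (intro comp_intro assms)+

lemma computable_in_entry [comp_intro]:
  assumes "computable_in A q" "computable_in A j"
  shows "computable_in A (\<lambda>x. refutations (q x) (j x))" "computable_in A (\<lambda>x. guess (q x) (j x))"
    "computable_in A (\<lambda>x. status (q x) (j x))"
  unfolding refutations_def guess_def status_def by (intro comp_intro assms)+

lemma computable_in_set_entry [comp_intro]:
  assumes "computable_in A q" "computable_in A j" "computable_in A k" "computable_in A m"
    "computable_in A y"
  shows "computable_in A (\<lambda>x. set_entry (q x) (j x) (k x) (m x) (y x))"
  unfolding set_entry_def by (intro comp_intro assms)

lemma decidable_in_chosen [comp_intro]:
  assumes "computable_in A i" "computable_in A n" "computable_in A k"
  shows "decidable_in A (\<lambda>x. chosen (bits (i x)) (n x) (k x))"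
  unfolding chosen_def by (intro comp_intro assms[THEN computable_in_compose])

lemma decidable_in_refuted [comp_intro]:
  assumes "computable_in A c" "computable_in A s" "computable_in A q" "computable_in A j"
  shows "decidable_in A (\<lambda>x. refuted (c x) (s x) (q x) (j x))"
  unfolding refuted_def by (intro comp_intro assms)

lemma computable_in_passive_step [comp_intro]:
  assumes "computable_in A c" "computable_in A i" "computable_in A s" "computable_in A q"
    "computable_in A j"
  shows "computable_in A (\<lambda>x. passive_step (c x) (bits (i x)) (s x) (q x) (j x))"
  unfolding passive_step_def by (intro comp_intro assms)

lemma computable_in_active_step [comp_intro]:
  assumes "computable_in A s" "computable_in A q" "computable_in A j"
  shows "computable_in A (\<lambda>x. active_step (s x) (q x) (j x))"
  unfolding active_step_def by (intro comp_intro assms)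

lemma computable_in_stage [comp_intro]:
  assumes "computable_in A c" "computable_in A i" "computable_in A s"
  shows "computable_in A (\<lambda>x. stage (c x) (bits (i x)) (s x))"
  unfolding stage_def stage_step_def by (intro comp_intro assms[THEN computable_in_compose])

subsection \<open>Invariants\<close>

lemma cprefix_refl [simp]: "cprefix m m"
  by (simp add: cprefix_iff)

lemma cprefix_trans: "cprefix m u \<Longrightarrow> cprefix u v \<Longrightarrow> cprefix m v"
  unfolding cprefix_iff by (rule prefix_order.trans)

lemma cprefix_csnoc [simp]: "cprefix m (csnoc m x)"
  using csnoc_list_encode[of "list_decode m" x] by (simp add: cprefix_iff)

lemma clen_csnoc [simp]: "clen (csnoc m x) = Suc (clen m)"
  using csnoc_list_encode[of "list_decode m" x] clen_list_encode[of "list_decode m"] by simp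

lemma cstring_0 [simp]: "cstring 0"
  unfolding cstring_iff by (rule exI[of _ "[]"]) simp

lemma cstring_csnoc [simp]: "cstring m \<Longrightarrow> cstring (csnoc m 0)"
  unfolding cstring_iff by auto

lemma fires_within_mono: "fires_within j m s \<Longrightarrow> s \<le> t \<Longrightarrow> fires_within j m t"
  unfolding fires_within_def by (meson halts_within_mono less_le_trans)

lemma fires_iff:
  "fires j m \<longleftrightarrow> (\<exists>u t. cstring u \<and> cprefix m u \<and> halts_within j u t)"
proof
  assume "\<exists>u t. cstring u \<and> cprefix m u \<and> halts_within j u t"
  then obtain u t where "cstring u" "cprefix m u" "halts_within j u t" by blast
  then have "fires_within j m (max (Suc u) t)"
    unfolding fires_within_def by (intro exI[of _ u]) (auto intro: halts_within_mono)
  then show "fires j m" unfolding fires_def by blast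
qed (auto simp: fires_def fires_within_def)

lemma fires_antimono: "cprefix m u \<Longrightarrow> fires j u \<Longrightarrow> fires j m"
  unfolding fires_iff by (meson cprefix_trans)

lemma spark:
  assumes "fires_within j m s"
  shows "cstring (spark j m s)" "cprefix m (spark j m s)" "halts_within j (spark j m s) s"
proof -
  obtain u where u: "u < s" "cstring u" "cprefix m u" "halts_within j u s"
    using assms unfolding fires_within_def by blast
  let ?P = "\<lambda>u. s \<le> u \<or> cstring u \<and> cprefix m u \<and> halts_within j u s"
  have "?P (spark j m s)" "spark j m s \<le> u"
    unfolding spark_def by (rule LeastI[of ?P u], simp add: u) (rule Least_le, simp add: u)
  with u(1) show "cstring (spark j m s)" "cprefix m (spark j m s)" "halts_within j (spark j m s) s"
    by auto
qed

lemma state_simps [simp]: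
  "str_of (state m t a r) = m" "time_of (state m t a r) = t"
  "active_of (state m t a r) = a" "array_of (state m t a r) = r"
  by (simp_all add: state_def str_of_def time_of_def active_of_def array_of_def)

lemma entry_simps [simp]:
  "refutations (state m t a (set_entry q j k u x)) i = (if i = j then k else refutations q i)"
  "guess (state m t a (set_entry q j k u x)) i = (if i = j then u else guess q i)"
  "status (state m t a (set_entry q j k u x)) i = (if i = j then x else status q i)"
  "refutations (state m t a (array_of q)) i = refutations q i"
  "guess (state m t a (array_of q)) i = guess q i"
  "status (state m t a (array_of q)) i = status q i"
  by (simp_all add: refutations_def guess_def status_def set_entry_def)

lemma initial_state [simp]:
  "str_of 0 = 0" "time_of 0 = 0" "active_of 0 = 0"
  "refutations 0 j = 0" "guess 0 j = 0" "status 0 j = 0"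
  by (simp_all add: str_of_def time_of_def active_of_def array_of_def refutations_def guess_def status_def)

lemmas step_defs = stage_step_def passive_step_def active_step_def

lemma stage_0 [simp]: "stage c X 0 = 0"
  and stage_Suc: "stage c X (Suc s) = stage_step c X s (stage c X s)"
  by (simp_all add: stage_def)

lemma cstring_stage: "cstring (str_of (stage c X s))"
  by (induction s) (auto simp: stage_Suc step_defs spark)

lemma str_of_stage_mono: "s \<le> t \<Longrightarrow> cprefix (str_of (stage c X s)) (str_of (stage c X t))"
proof (induction rule: dec_induct)
  case (step t)
  have "cprefix (str_of (stage c X t)) (str_of (stage c X (Suc t)))"
    by (auto simp: stage_Suc step_defs spark)
  with step.IH show ?case by (rule cprefix_trans)
qed simp

lemma guess_stage: "cprefix (guess (stage c X s) j) (str_of (stage c X s))"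
proof (induction s)
  case (Suc s)
  have "guess (stage c X (Suc s)) j = guess (stage c X s) j \<or>
      guess (stage c X (Suc s)) j = str_of (stage c X (Suc s))"
    by (auto simp: stage_Suc step_defs)
  then show ?case
    using cprefix_trans[OF Suc str_of_stage_mono[of s "Suc s" c X]] by auto
qed simp

lemma stage_step_cases:
  obtains (pass) "active_of q = 0" "\<not> refuted c s q (pfst (time_of q))"
      "stage_step c X s q = state (csnoc (str_of q) 0) (Suc (time_of q)) 0 (array_of q)"
  | (activate) j where "active_of q = 0" "j = pfst (time_of q)" "refuted c s q j"
      "chosen X (pair c j) (refutations q j)"
      "stage_step c X s q = state (csnoc (str_of q) 0) (Suc (time_of q)) (Suc j)
         (set_entry q j (refutations q j) (guess q j) 1)"
  | (retry) j where "active_of q = 0" "j = pfst (time_of q)" "refuted c s q j"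
      "\<not> chosen X (pair c j) (refutations q j)"
      "stage_step c X s q = state (csnoc (str_of q) 0) (Suc (time_of q)) 0
         (set_entry q j (Suc (refutations q j)) (csnoc (str_of q) 0) 0)"
  | (fulfil) j where "active_of q = Suc j" "fires_within j (str_of q) s"
      "stage_step c X s q = state (spark j (str_of q) s) (time_of q) 0
         (set_entry q j (refutations q j) (guess q j) 2)"
  | (wait) j where "active_of q = Suc j" "\<not> fires_within j (str_of q) s" "stage_step c X s q = q"
proof (cases "active_of q")
  case 0
  then show ?thesis
    using pass activate retry by (cases "refuted c s q (pfst (time_of q))";
      cases "chosen X (pair c (pfst (time_of q))) (refutations q (pfst (time_of q)))")
      (simp_all add: stage_step_def passive_step_def)
next
  case (Suc j)
  then show ?thesis
    using fulfil wait by (cases "fires_within j (str_of q) s")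
      (simp_all add: stage_step_def active_step_def)
qed

lemma active_iff_status: "active_of (stage c X s) = Suc j \<longleftrightarrow> status (stage c X s) j = 1"
proof (induction s arbitrary: j)
  case (Suc s)
  show ?case
  proof (cases rule: stage_step_cases[of "stage c X s" c s X])
    case pass
    with Suc[of j] show ?thesis by (simp add: stage_Suc)
  next
    case (activate i)
    with Suc[of j] show ?thesis by (auto simp: stage_Suc)
  next
    case (retry i)
    with Suc[of j] show ?thesis by (simp add: stage_Suc)
  next
    case (fulfil i)
    with Suc[of j] show ?thesis by (auto simp: stage_Suc)
  next
    case (wait i)
    with Suc[of j] show ?thesis by (simp add: stage_Suc)
  qed
qed simp

lemma status_satisfied:
  "status (stage c X s) j = 2 \<Longrightarrow>
    \<exists>u t. cstring u \<and> cprefix u (str_of (stage c X s)) \<and> halts_within j u t"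
proof (induction s)
  case (Suc s)
  show ?case
  proof (cases "status (stage c X s) j = 2")
    case True
    with Suc.IH show ?thesis
      using cprefix_trans str_of_stage_mono[of s "Suc s" c X] by (meson le_Suc_eq order_refl)
  next
    case False
    show ?thesis
    proof (cases rule: stage_step_cases[of "stage c X s" c s X])
      case (fulfil i)
      with False Suc.prems have "i = j" by (auto simp: stage_Suc split: if_splits)
      with fulfil have "str_of (stage c X (Suc s)) = spark j (str_of (stage c X s)) s"
        by (simp add: stage_Suc)
      then show ?thesis
        using spark[OF fulfil(2)] \<open>i = j\<close> by (metis cprefix_refl)
    qed (use False Suc.prems in \<open>auto simp: stage_Suc split: if_splits\<close>)
  qed
qed simp

text \<open>This makes the start and the end of a wait events that persist once they are seen, as
  the nested open sets of the test require.\<close>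

lemma status_stage_mono: "s \<le> t \<Longrightarrow> status (stage c X s) j \<le> status (stage c X t) j"
proof (induction rule: dec_induct)
  case (step t)
  have "status (stage c X t) j \<le> status (stage c X (Suc t)) j"
  proof (cases rule: stage_step_cases[of "stage c X t" c t X])
    case (fulfil i)
    then have "status (stage c X t) i = 1" using active_iff_status by simp
    with fulfil show ?thesis by (simp add: stage_Suc)
  qed (auto simp: stage_Suc refuted_def)
  with step.IH show ?case by simp
qed simp

lemma status_le_2: "status (stage c X s) j \<le> 2"
  by (induction s) (auto simp: stage_Suc step_defs)

lemma refutations_stage_mono: "s \<le> t \<Longrightarrow> refutations (stage c X s) j \<le> refutations (stage c X t) j"
proof (induction rule: dec_induct)
  case (step t)
  have "refutations (stage c X t) j \<le> refutations (stage c X (Suc t)) j"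
    by (auto simp: stage_Suc step_defs)
  with step.IH show ?case by simp
qed simp

lemma chosen_cong:
  assumes "\<And>k. k < (n + 3) ^ 2 \<Longrightarrow> X k = Y k"
  shows "chosen X n k = chosen Y n k"
proof -
  have "(n + 2) ^ 2 + i < (n + 3) ^ 2" if "i < n + 2" for i
    using that by (simp add: power2_eq_square algebra_simps)
  with assms show ?thesis by (simp add: chosen_def)
qed

lemma stage_cong:
  assumes "\<And>k. k < s \<Longrightarrow> X k = Y k"
  shows "stage c X s = stage c Y s"
  using assms
proof (induction s)
  case (Suc s)
  then have eq: "stage c X s = stage c Y s" by simp
  have "refuted c s q j \<Longrightarrow> chosen X (pair c j) k = chosen Y (pair c j) k" for q j k
    using Suc.prems by (intro chosen_cong) (auto simp: refuted_def)
  then show ?case by (auto simp: stage_Suc eq step_defs)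
qed simp

text \<open>Links the run on \<open>X\<close> to a run on a finite oracle. It serves both the
  reduction to \<open>X\<close> and the effectiveness of the failure events.\<close>

lemma stage_bits_initial: "s \<le> t \<Longrightarrow> stage c (bits (initial X t)) s = stage c X s"
  by (rule stage_cong) (simp add: bits_initial)

subsection \<open>At most one choice is bad\<close>

definition stuck :: "nat \<Rightarrow> nat \<Rightarrow> cantor \<Rightarrow> bool" where
  "stuck c j X \<longleftrightarrow> (\<exists>s. status (stage c X s) j \<ge> 1) \<and> (\<forall>s. status (stage c X s) j \<noteq> 2)"

definition block :: "nat \<Rightarrow> nat set" where
  "block n = {(n + 2) ^ 2..<(n + 2) ^ 2 + (n + 2)}"

lemma chosen_block: "chosen X n k \<longleftrightarrow> (\<forall>x\<in>block n. X x \<longleftrightarrow> bits k (x - (n + 2) ^ 2))"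
proof
  assume *: "chosen X n k"
  show "\<forall>x\<in>block n. X x \<longleftrightarrow> bits k (x - (n + 2) ^ 2)"
  proof
    fix x assume "x \<in> block n"
    then obtain i where "x = (n + 2) ^ 2 + i" "i < n + 2"
      unfolding block_def by (metis atLeastLessThan_iff le_Suc_ex nat_add_left_cancel_less)
    with * show "X x \<longleftrightarrow> bits k (x - (n + 2) ^ 2)" by (simp add: chosen_def)
  qed
qed (simp add: chosen_def block_def)

lemma block_disjoint:
  assumes "m \<noteq> n"
  shows "block m \<inter> block n = {}"
proof -
  have "block m \<inter> block n = {}" if "m < n" for m n
  proof -
    have "(m + 2) ^ 2 + (m + 2) \<le> (m + 3) ^ 2"
      by (simp add: power2_eq_square algebra_simps)
    also have "\<dots> \<le> (n + 2) ^ 2" using that by (intro power_mono) auto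
    finally show ?thesis by (auto simp: block_def)
  qed
  with assms show ?thesis by (metis inf_commute linorder_neqE_nat)
qed

text \<open>The stage is the last one before the wait. No extension can ever appear: the wait
  freezes the state, so the extension would be noticed at some later stage.\<close>

lemma stuck_activation:
  assumes "stuck c j X"
  obtains s where "\<forall>t\<le>s. status (stage c X t) j = 0"
    "active_of (stage c X s) = 0" "pfst (time_of (stage c X s)) = j"
    "refuted c s (stage c X s) j" "chosen X (pair c j) (refutations (stage c X s) j)"
    "\<not> fires j (csnoc (str_of (stage c X s)) 0)"
proof -
  define r where "r = (LEAST s. status (stage c X s) j \<ge> 1)"
  have r: "status (stage c X r) j \<ge> 1"
    using assms unfolding stuck_def r_def by (auto intro: LeastI_ex)
  have less: "status (stage c X s) j = 0" if "s < r" for s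
    using not_less_Least[of s "\<lambda>s. status (stage c X s) j \<ge> 1"] that unfolding r_def by simp
  have "r \<noteq> 0" using r by (rule contrapos_pn) simp
  then obtain s where s: "r = Suc s" using not0_implies_Suc by blast
  let ?q = "stage c X s"
  have 0: "status ?q j = 0" using less s by simp
  have not2: "status (stage c X t) j \<noteq> 2" for t
    using assms unfolding stuck_def by blast
  have r1: "status (stage c X t) j = 1" if "t \<ge> r" for t
    using status_stage_mono[OF that, of c X j] r status_le_2[of c X t j] not2[of t] by linarith
  have "active_of ?q = 0 \<and> pfst (time_of ?q) = j \<and> refuted c s ?q j \<and>
      chosen X (pair c j) (refutations ?q j) \<and> str_of (stage c X r) = csnoc (str_of ?q) 0"
    using 0 r1[of r]
    by (cases rule: stage_step_cases[of ?q c s X]) (auto simp: s stage_Suc split: if_splits)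
  moreover have "\<not> fires_within j (str_of (stage c X r)) u" for u
  proof
    assume "fires_within j (str_of (stage c X r)) u"
    moreover have "stage c X t = stage c X r" if "t \<ge> r" "t \<le> max r u" for t
      using that
    proof (induction rule: dec_induct)
      case (step t)
      have "active_of (stage c X t) = Suc j" using active_iff_status r1[of t] step by simp
      moreover have "active_of (stage c X (Suc t)) = Suc j" using active_iff_status r1[of "Suc t"] step by simp
      ultimately have "stage c X (Suc t) = stage c X t"
        by (cases rule: stage_step_cases[of "stage c X t" c t X]) (simp_all add: stage_Suc)
      with step show ?case by simp
    qed simp
    from this[of "max r u"] have "stage c X (max r u) = stage c X r" by simp
    ultimately have "fires_within j (str_of (stage c X (max r u))) (max r u)"
      by (metis fires_within_mono max.cobounded2)
    moreover have "active_of (stage c X (max r u)) = Suc j" "active_of (stage c X (Suc (max r u))) = Suc j"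
      using active_iff_status r1 by simp_all
    ultimately show False
      by (simp add: stage_Suc step_defs)
  qed
  ultimately show ?thesis
    using that[of s] less s by (simp add: fires_def)
qed

text \<open>
  Suppose that requirement \<open>j\<close> starts to wait in the run on \<open>X\<close> no later than in the run on \<open>Y\<close>.
  Up to that point the runs agree. If \<open>Y\<close> chose a different number there, then it would guess that
  the string at which \<open>X\<close> is stuck cannot be extended; as this is true, \<open>Y\<close> would never start to wait.
\<close>

lemma stuck_unique:
  assumes "stuck c j X" "stuck c j Y" and agree: "\<And>k. k \<notin> block (pair c j) \<Longrightarrow> X k = Y k"
  shows "X = Y"
proof -
  \<comment> \<open>Stated with the earlier wait in \<open>X\<close>, so that it can be used in both
    directions. A common \<open>k\<close> is enough, since it fixes all bits of the block.\<close>
  have main: "\<exists>k. chosen X (pair c j) k \<and> chosen Y (pair c j) k"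
    if agree: "\<And>k. k \<notin> block (pair c j) \<Longrightarrow> X k = Y k"
      and X: "\<forall>t\<le>s. status (stage c X t) j = 0"
        "active_of (stage c X s) = 0" "pfst (time_of (stage c X s)) = j"
        "refuted c s (stage c X s) j" "chosen X (pair c j) (refutations (stage c X s) j)"
        "\<not> fires j (csnoc (str_of (stage c X s)) 0)"
      and Y: "\<forall>t\<le>u. status (stage c Y t) j = 0"
        "refuted c u (stage c Y u) j" "chosen Y (pair c j) (refutations (stage c Y u) j)"
      and "s \<le> u" for X Y s u
  proof (rule ccontr)
    assume neg: "\<not> ?thesis"
    have other: "chosen X (pair c i) k = chosen Y (pair c i) k" if "i \<noteq> j" for i k
    proof -
      have "x \<notin> block (pair c j)" if "x \<in> block (pair c i)" for x
        using that block_disjoint[of "pair c i" "pair c j"] \<open>i \<noteq> j\<close> by auto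
      then show ?thesis using agree by (auto simp: chosen_block)
    qed
    \<comment> \<open>Before the wait of \<open>X\<close>, requirement \<open>j\<close> has status
      \<open>0\<close> in both runs, so every refutation led to a new guess in both; the bits in
      which they differ have left no trace.\<close>
    have same: "stage c X t = stage c Y t" if "t \<le> s" for t
      using that
    proof (induction t)
      case (Suc t)
      then have eq: "stage c X t = stage c Y t" by simp
      let ?q = "stage c Y t"
      have 0: "status (stage c X (Suc t)) j = 0" "status (stage c Y (Suc t)) j = 0"
        using X(1) Y(1) Suc.prems \<open>s \<le> u\<close> by auto
      show ?case
        using other[of "pfst (time_of ?q)" "refutations ?q (pfst (time_of ?q))"] 0
        by (cases rule: stage_step_cases[of ?q c t Y]; cases rule: stage_step_cases[of ?q c t X])
          (auto simp: stage_Suc eq split: if_splits)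
    qed simp
    let ?m = "csnoc (str_of (stage c X s)) 0"
    have not: "\<not> chosen Y (pair c j) (refutations (stage c X s) j)"
      using neg X(5) by blast
    have "refuted c s (stage c Y s) j" "active_of (stage c Y s) = 0" "pfst (time_of (stage c Y s)) = j"
      using X same by simp_all
    moreover have "status (stage c Y (Suc s)) j = 0"
      using not same[of s] X by (simp add: stage_Suc step_defs)
    ultimately have start: "guess (stage c Y (Suc s)) j = ?m" "str_of (stage c Y (Suc s)) = ?m"
      using not same[of s] by (simp_all add: stage_Suc step_defs)
    \<comment> \<open>Later guesses for \<open>j\<close> in the run on \<open>Y\<close> only extend
      \<open>?m\<close>; refuting one of them would refute \<open>?m\<close>, which has no extension
      in the set.\<close>
    have "cprefix ?m (guess (stage c Y t) j)" if "Suc s \<le> t" for t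
      using that
    proof (induction rule: dec_induct)
      case base
      show ?case using start by simp
    next
      case (step t)
      have "guess (stage c Y (Suc t)) j = guess (stage c Y t) j \<or>
          guess (stage c Y (Suc t)) j = str_of (stage c Y (Suc t))"
        by (auto simp: stage_Suc step_defs)
      moreover have "cprefix ?m (str_of (stage c Y (Suc t)))"
        using str_of_stage_mono[of "Suc s" "Suc t" c Y] start(2) step by simp
      ultimately show ?case using step.IH by auto
    qed
    moreover have "u \<noteq> s"
      using Y(3) not same[of s] by auto
    ultimately have "cprefix ?m (guess (stage c Y u) j)" using \<open>s \<le> u\<close> by simp
    with Y(2) X(6) show False
      using fires_antimono unfolding refuted_def fires_def by blast
  qed
  obtain s where s: "\<forall>t\<le>s. status (stage c X t) j = 0"
    "active_of (stage c X s) = 0" "pfst (time_of (stage c X s)) = j"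
    "refuted c s (stage c X s) j" "chosen X (pair c j) (refutations (stage c X s) j)"
    "\<not> fires j (csnoc (str_of (stage c X s)) 0)"
    using stuck_activation[OF assms(1)] .
  obtain u where u: "\<forall>t\<le>u. status (stage c Y t) j = 0"
    "active_of (stage c Y u) = 0" "pfst (time_of (stage c Y u)) = j"
    "refuted c u (stage c Y u) j" "chosen Y (pair c j) (refutations (stage c Y u) j)"
    "\<not> fires j (csnoc (str_of (stage c Y u)) 0)"
    using stuck_activation[OF assms(2)] .
  have "\<exists>k. chosen X (pair c j) k \<and> chosen Y (pair c j) k"
  proof (cases "s \<le> u")
    case True
    then show ?thesis using main[OF agree s u(1,4,5)] by blast
  next
    case False
    then show ?thesis using main[OF agree[symmetric] u s(1,4,5)] by auto
  qed
  then have "X x = Y x" if "x \<in> block (pair c j)" for x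
    using that by (auto simp: chosen_block)
  with agree show ?thesis by blast
qed

subsection \<open>The limit of the construction\<close>

text \<open>When a wait ends, the construction is passive again with the clock unchanged; if it
  never ends, the state is frozen and the waiting requirement is stuck.\<close>

lemma reaches_passive:
  assumes "\<And>j. \<not> stuck c j X"
  shows "\<exists>t\<ge>s. active_of (stage c X t) = 0 \<and> time_of (stage c X t) = time_of (stage c X s)"
proof (rule ccontr)
  assume neg: "\<not> ?thesis"
  have const: "stage c X (s + k) = stage c X s" for k
  proof (induction k)
    case (Suc k)
    have ne: "active_of (stage c X (s + k)) \<noteq> 0" using neg Suc by auto
    show ?case
    proof (cases rule: stage_step_cases[of "stage c X (s + k)" c "s + k" X])
      case (fulfil i)
      then have "active_of (stage c X (Suc (s + k))) = 0"
        "time_of (stage c X (Suc (s + k))) = time_of (stage c X s)"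
        using Suc by (simp_all add: stage_Suc)
      with neg show ?thesis by (metis le_add1 le_SucI)
    qed (use ne Suc in \<open>simp_all add: stage_Suc\<close>)
  qed simp
  from neg obtain j where j: "active_of (stage c X s) = Suc j"
    by (metis not0_implies_Suc order_refl)
  have "status (stage c X (s + k)) j = 1" for k
    using const j active_iff_status by metis
  then have "status (stage c X t) j = 1" if "t \<ge> s" for t
    using that by (metis le_add_diff_inverse)
  moreover have "status (stage c X t) j \<le> 1" if "t \<le> s" for t
    using status_stage_mono[OF that, of c X j] calculation[of s] by simp
  ultimately have "stuck c j X"
    unfolding stuck_def
    by (metis Suc_1 not_less_eq_eq le_refl n_not_Suc_n nat_le_linear one_le_numeral)
  with assms show False by blast
qed

lemma passive_at_time:
  assumes "\<And>j. \<not> stuck c j X"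
  shows "\<exists>s. active_of (stage c X s) = 0 \<and> time_of (stage c X s) = t"
proof (induction t)
  case 0
  show ?case by (rule exI[of _ 0]) simp
next
  case (Suc t)
  then obtain s where s: "active_of (stage c X s) = 0" "time_of (stage c X s) = t" by blast
  have "time_of (stage c X (Suc s)) = Suc t"
    using s by (cases rule: stage_step_cases[of "stage c X s" c s X]) (simp_all add: stage_Suc)
  with reaches_passive[OF assms, of "Suc s"] show ?case by auto
qed

lemma time_of_stage_le: "time_of (stage c X s) \<le> s"
proof (induction s)
  case (Suc s)
  then show ?case
    by (cases rule: stage_step_cases[of "stage c X s" c s X]) (simp_all add: stage_Suc)
qed simp

text \<open>Each tick of the clock appends a bit and a fulfilled wait never shortens the string.
  Since the clock takes all values, the strings grow without bound.\<close>

lemma time_of_le_clen: "time_of (stage c X s) \<le> clen (str_of (stage c X s))"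
proof (induction s)
  case (Suc s)
  show ?case
  proof (cases rule: stage_step_cases[of "stage c X s" c s X])
    case (fulfil i)
    then show ?thesis
      using Suc spark(2)[OF fulfil(2)] by (simp add: stage_Suc cprefix_def)
  qed (use Suc in \<open>simp_all add: stage_Suc\<close>)
qed simp

lemma clen_unbounded:
  assumes "\<And>j. \<not> stuck c j X"
  shows "\<exists>s. k < clen (str_of (stage c X s))"
proof -
  obtain s where "time_of (stage c X s) = Suc k"
    using passive_at_time[OF assms] by blast
  then show ?thesis using time_of_le_clen[of c X s] by (intro exI[of _ s]) simp
qed

definition limit :: "nat \<Rightarrow> cantor \<Rightarrow> cantor" where
  "limit c X k \<longleftrightarrow> cnth (str_of (stage c X (LEAST s. k < clen (str_of (stage c X s))))) k = 1"

lemma limit_eq: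
  assumes "k < clen (str_of (stage c X s))"
  shows "limit c X k \<longleftrightarrow> cnth (str_of (stage c X s)) k = 1"
proof -
  let ?P = "\<lambda>s. k < clen (str_of (stage c X s))"
  have "?P (Least ?P)" "Least ?P \<le> s"
    using assms by (rule LeastI[of ?P], rule Least_le[of ?P])
  then show ?thesis
    using str_of_stage_mono[of "Least ?P" s c X] unfolding limit_def cprefix_def by metis
qed

lemma is_prefix_limit:
  assumes "str_encode \<sigma> = m" "cprefix m (str_of (stage c X s))"
  shows "is_prefix \<sigma> (limit c X)"
  unfolding is_prefix_def
proof (intro allI impI)
  fix i assume i: "i < length \<sigma>"
  then have "i < clen (str_of (stage c X s))" "cnth (str_of (stage c X s)) i = of_bool (\<sigma> ! i)"
    using assms unfolding cprefix_def by auto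
  then show "limit c X i = \<sigma> ! i"
    using limit_eq[of i c X s] by simp
qed

lemma cstring_cprefix: "cprefix m u \<Longrightarrow> cstring u \<Longrightarrow> cstring m"
  by (auto simp: cprefix_def cstring_def)

lemma ex_chosen: "\<exists>k. chosen X n k"
  by (rule exI[of _ "initial (\<lambda>i. X ((n + 2) ^ 2 + i)) (n + 2)"])
    (simp add: chosen_def bits_initial)

text \<open>At a chosen count the requirement would wait instead of guessing anew, so the
  refutations are bounded and some guess is final. A false final guess would be acted upon at a late
  enough turn of \<open>j\<close>.\<close>

lemma guess_correct:
  assumes free: "\<And>i. \<not> stuck c i X" and 0: "\<And>s. status (stage c X s) j = 0"
  shows "\<exists>s. \<not> fires j (guess (stage c X s) j)"
proof -
  obtain K where K: "chosen X (pair c j) K" using ex_chosen by blast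
  have bound: "refutations (stage c X s) j \<le> K" for s
  proof (induction s)
    case (Suc s)
    show ?case
    proof (cases rule: stage_step_cases[of "stage c X s" c s X])
      case (retry i)
      with K have "i = j \<Longrightarrow> refutations (stage c X s) j \<noteq> K" by auto
      with retry Suc show ?thesis by (auto simp: stage_Suc)
    qed (use Suc in \<open>auto simp: stage_Suc\<close>)
  qed simp
  have "\<exists>s. \<forall>t. refutations (stage c X t) j \<le> refutations (stage c X s) j"
    using ex_has_greatest_nat[of "\<lambda>_. True" 0 "\<lambda>s. refutations (stage c X s) j" "Suc K"] bound
    by (auto simp: less_Suc_eq_le)
  then obtain s where s: "\<And>t. refutations (stage c X t) j \<le> refutations (stage c X s) j" by blast
  have same: "refutations (stage c X t) j = refutations (stage c X s) j" if "s \<le> t" for t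
    using s[of t] refutations_stage_mono[OF that, of c X j] by simp
  have guess: "guess (stage c X t) j = guess (stage c X s) j" if "s \<le> t" for t
    using that
  proof (induction rule: dec_induct)
    case (step t)
    show ?case
    proof (cases rule: stage_step_cases[of "stage c X t" c t X])
      case (retry i)
      then have "i = j \<Longrightarrow> refutations (stage c X (Suc t)) j = Suc (refutations (stage c X t) j)"
        by (simp add: stage_Suc)
      with same[of t] same[of "Suc t"] step have "i \<noteq> j" by auto
      with retry step show ?thesis by (simp add: stage_Suc)
    qed (use step in \<open>auto simp: stage_Suc\<close>)
  qed simp
  have "\<not> fires j (guess (stage c X s) j)"
  proof
    assume "fires j (guess (stage c X s) j)"
    then obtain r where r: "fires_within j (guess (stage c X s) j) r"
      unfolding fires_def by blast
    \<comment> \<open>A clock value that belongs to \<open>j\<close> and is so late that the count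
      is final, the refutation is visible and the block may be read; the stage is never smaller than
      the clock value.\<close>
    define t where "t = pair j (s + r + (pair c j + 3) ^ 2)"
    obtain u where u: "active_of (stage c X u) = 0" "time_of (stage c X u) = t"
      using passive_at_time[OF free] by blast
    have "s + r + (pair c j + 3) ^ 2 \<le> t" unfolding t_def by (rule le_prod_encode_2)
    also have "\<dots> \<le> u" using time_of_stage_le[of c X u] u by simp
    finally have le: "s \<le> u" "r \<le> u" "(pair c j + 3) ^ 2 \<le> u" by simp_all
    have ref: "refuted c u (stage c X u) j"
      using 0 guess[OF le(1)] fires_within_mono[OF r le(2)] le(3) by (simp add: refuted_def)
    have j: "pfst (time_of (stage c X u)) = j" by (simp add: u t_def)
    show False
    proof (cases rule: stage_step_cases[of "stage c X u" c u X])
      case (activate i)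
      then have "status (stage c X (Suc u)) j = 1" using j by (simp add: stage_Suc)
      with 0 show False by simp
    next
      case (retry i)
      then have "refutations (stage c X (Suc u)) j = Suc (refutations (stage c X u) j)"
        using j by (simp add: stage_Suc)
      with same[of u] same[of "Suc u"] le(1) show False by simp
    qed (use u ref j in simp_all)
  qed
  then show ?thesis by blast
qed

lemma one_generic_limit:
  assumes free: "\<And>j. \<not> stuck c j X"
  shows "one_generic (limit c X)"
  unfolding one_generic_def
proof (intro allI impI)
  fix S assume "ce_strings S"
  then obtain p where p: "S = halting_strings p" unfolding ce_strings_def by blast
  define j where "j = goedel p"
  have S: "\<sigma> \<in> S \<longleftrightarrow> (\<exists>t. halts_within j (str_encode \<sigma>) t)" for \<sigma>
    unfolding p j_def halting_strings_def halts_within_goedel_iff by simp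
  show "(\<exists>\<sigma>. is_prefix \<sigma> (limit c X) \<and> \<sigma> \<in> S) \<or>
      (\<exists>\<sigma>. is_prefix \<sigma> (limit c X) \<and> (\<forall>\<tau>. prefix \<sigma> \<tau> \<longrightarrow> \<tau> \<notin> S))"
  proof (cases "\<exists>s. status (stage c X s) j = 2")
    case True
    then obtain s where "status (stage c X s) j = 2" by blast
    then obtain u t where u: "cstring u" "cprefix u (str_of (stage c X s))" "halts_within j u t"
      using status_satisfied by blast
    then obtain \<sigma> where "u = str_encode \<sigma>" unfolding cstring_iff by blast
    with u show ?thesis using is_prefix_limit[of \<sigma> u c X s] S by blast
  next
    case False
    then have "status (stage c X s) j = 0" for s
      using free[of j] unfolding stuck_def by (metis less_one not_less)
    then obtain s where s: "\<not> fires j (guess (stage c X s) j)"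
      using guess_correct[OF free] by blast
    have "\<exists>\<sigma>. guess (stage c X s) j = str_encode \<sigma>"
      using cstring_cprefix[OF guess_stage cstring_stage] unfolding cstring_iff .
    then obtain \<sigma> where \<sigma>: "guess (stage c X s) j = str_encode \<sigma>" by blast
    have "\<tau> \<notin> S" if "prefix \<sigma> \<tau>" for \<tau>
      using s that unfolding fires_iff S \<sigma> cstring_iff by (metis cprefix_str_encode)
    moreover have "is_prefix \<sigma> (limit c X)"
      using is_prefix_limit[OF \<sigma>[symmetric] guess_stage] .
    ultimately show ?thesis by blast
  qed
qed

lemma limit_le:
  assumes free: "\<And>j. \<not> stuck c j X"
  shows "limit c X \<le>\<^sub>T X"
proof -
  \<comment> \<open>Computability of the stages is available for finite oracles passed as numbers,
    so stage \<open>s\<close> is computed from the first \<open>s\<close> bits of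
    \<open>X\<close>.\<close>
  define st where "st s = str_of (stage c (bits (initial X s)) s)" for s
  have st: "st s = str_of (stage c X s)" for s
    by (simp add: st_def stage_bits_initial)
  have comp: "computable_in X f \<Longrightarrow> computable_in X (\<lambda>n. st (f n))" for f
    unfolding st_def by (intro comp_intro)
  have "decidable_in X (\<lambda>k. cnth (st (LEAST s. k < clen (st s))) k = 1)"
  proof (intro comp_intro comp)
    show "\<exists>s. k < clen (st s)" for k
      using clen_unbounded[OF free] by (simp add: st)
  qed
  then have "decidable_in X (limit c X)"
    by (simp add: limit_def[abs_def] st)
  then show ?thesis
    unfolding turing_le_def decidable_in_def computable_in_def .
qed

section \<open>Measure\<close>

lemma space_coin_measure [simp]: "space coin_measure = UNIV"
  by (simp add: coin_measure_def space_PiM)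

interpretation coin: prob_space coin_measure
  unfolding coin_measure_def by (intro prob_space_PiM prob_space_measure_pmf)

lemma initial_vimage_cylinder:
  assumes "i < 2 ^ s"
  shows "{X. initial X s = i} = cylinder (map (bits i) [0..<s])"
proof -
  have "initial X s = i \<longleftrightarrow> (\<forall>k<s. X k = bits i k)" for X
  proof
    assume "\<forall>k<s. X k = bits i k"
    then have "initial X s = initial (bits i) s"
      unfolding initial_def by (metis (no_types, lifting))
    with assms show "initial X s = i" by (simp add: initial_bits)
  qed (metis bits_initial)
  then show ?thesis by (auto simp: cylinder_def is_prefix_def)
qed

lemma initial_vimage_eq:
  "{X. P (initial X s)} = (\<Union>i\<in>{i. i < 2 ^ s \<and> P i}. cylinder (map (bits i) [0..<s]))"
proof -
  have "{X. P (initial X s)} = (\<Union>i\<in>{i. i < 2 ^ s \<and> P i}. {X. initial X s = i})"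
    using initial_less by auto
  then show ?thesis using initial_vimage_cylinder by auto
qed

lemma initial_vimage_in_sets: "{X. P (initial X s)} \<in> sets coin_measure"
  unfolding initial_vimage_eq by (intro sets.finite_UN) (auto simp: cylinder_in_sets)

lemma measure_initial_vimage:
  "measure coin_measure {X. P (initial X s)} = card {i. i < 2 ^ s \<and> P i} / 2 ^ s"
proof -
  let ?C = "\<lambda>i. cylinder (map (bits i) [0..<s])"
  have "disjoint_family_on ?C {i. i < 2 ^ s \<and> P i}"
    unfolding disjoint_family_on_def using initial_vimage_cylinder[symmetric] by auto
  then have "measure coin_measure {X. P (initial X s)} =
      (\<Sum>i | i < 2 ^ s \<and> P i. measure coin_measure (?C i))"
    unfolding initial_vimage_eq
    by (intro coin.finite_measure_finite_Union) (auto simp: cylinder_in_sets)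
  then show ?thesis by (simp add: measure_cylinder power_one_over field_simps)
qed

section \<open>Invariance of the measure under bit flips\<close>

definition flip :: "nat set \<Rightarrow> cantor \<Rightarrow> cantor" where
  "flip D X = (\<lambda>k. X k \<noteq> (k \<in> D))"

lemma emeasure_bernoulli_half_vimage_Not:
  "emeasure (measure_pmf (bernoulli_pmf (1/2))) (Not -` F) = emeasure (measure_pmf (bernoulli_pmf (1/2))) F"
proof -
  have "map_pmf Not (bernoulli_pmf (1/2)) = bernoulli_pmf (1/2)"
  proof (rule pmf_eqI)
    fix b
    have "pmf (map_pmf Not (bernoulli_pmf (1/2))) (\<not> \<not> b) = pmf (bernoulli_pmf (1/2)) (\<not> b)"
      by (rule pmf_map_inj') (rule injI, simp)
    then show "pmf (map_pmf Not (bernoulli_pmf (1/2))) b = pmf (bernoulli_pmf (1/2)) b"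
      by (simp add: pmf_bernoulli_half)
  qed
  then show ?thesis by (metis emeasure_map_pmf)
qed

lemma measurable_flip: "flip D \<in> measurable coin_measure coin_measure"
proof -
  have "(\<lambda>X k. X k \<noteq> (k \<in> D)) \<in> measurable coin_measure coin_measure"
    unfolding coin_measure_def
  proof (rule measurable_PiM_single')
    fix k :: nat
    show "(\<lambda>X. X k \<noteq> (k \<in> D)) \<in> measurable (\<Pi>\<^sub>M i\<in>UNIV. measure_pmf (bernoulli_pmf (1/2)))
        (measure_pmf (bernoulli_pmf (1/2)))"
      by (rule measurable_compose[OF measurable_component_singleton[of k]]) auto
  qed auto
  then show ?thesis by (simp add: flip_def[abs_def])
qed

text \<open>\<open>flip D\<close> is translation by the indicator of \<open>D\<close> in the group
  of binary sequences. It suffices to compare boxes, where each coordinate keeps its measure because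
  a bit is fair.\<close>

lemma distr_flip: "distr coin_measure coin_measure (flip D) = coin_measure"
proof -
  let ?M = "\<lambda>_::nat. measure_pmf (bernoulli_pmf (1/2))"
  interpret product_prob_space ?M UNIV
    by unfold_locales
  have "distr coin_measure coin_measure (flip D) = PiM UNIV ?M"
  proof (rule PiM_eq)
    fix J :: "nat set" and F assume J: "finite J"
    let ?F = "\<lambda>j. if j \<in> D then Not -` F j else F j"
    have "flip D -` prod_emb UNIV ?M J (Pi\<^sub>E J F) = prod_emb UNIV ?M J (Pi\<^sub>E J ?F)"
    proof -
      have "flip D X j \<in> F j \<longleftrightarrow> X j \<in> ?F j" for X j
        by (cases "j \<in> D") (auto simp: flip_def)
      then show ?thesis by (auto simp: prod_emb_def PiE_iff)
    qed
    then have "emeasure (distr coin_measure coin_measure (flip D)) (prod_emb UNIV ?M J (Pi\<^sub>E J F)) =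
        emeasure (PiM UNIV ?M) (prod_emb UNIV ?M J (Pi\<^sub>E J ?F))"
      using J by (subst emeasure_distr[OF measurable_flip])
        (auto simp: coin_measure_def space_PiM intro!: sets_PiM_I)
    also have "\<dots> = (\<Prod>j\<in>J. emeasure (?M j) (?F j))"
      using J by (intro emeasure_PiM_emb) auto
    also have "\<dots> = (\<Prod>j\<in>J. emeasure (?M j) (F j))"
      by (intro prod.cong) (auto simp: emeasure_bernoulli_half_vimage_Not)
    finally show "emeasure (distr coin_measure coin_measure (flip D)) (prod_emb UNIV ?M J (Pi\<^sub>E J F)) =
        (\<Prod>j\<in>J. emeasure (?M j) (F j))" .
  qed (simp_all add: coin_measure_def)
  then show ?thesis by (simp add: coin_measure_def)
qed

text \<open>The translates of \<open>E\<close> by the subsets of \<open>D\<close> are disjoint and all have the measure of \<open>E\<close>.\<close>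

lemma measure_selector_le:
  assumes E: "E \<in> sets coin_measure" and "finite D"
    and unique: "\<And>X Y. X \<in> E \<Longrightarrow> Y \<in> E \<Longrightarrow> (\<And>k. k \<notin> D \<Longrightarrow> X k = Y k) \<Longrightarrow> X = Y"
  shows "measure coin_measure E \<le> (1/2) ^ card D"
proof -
  have sets: "flip B -` E \<in> sets coin_measure" for B
    using measurable_sets[OF measurable_flip E] by simp
  have meas: "measure coin_measure (flip B -` E) = measure coin_measure E" for B
    using measure_distr[OF measurable_flip E, of B] by (simp add: distr_flip)
  have "disjoint_family_on (\<lambda>B. flip B -` E) (Pow D)"
    unfolding disjoint_family_on_def
  proof (intro ballI impI equals0I)
    fix B B' X assume B: "B \<in> Pow D" "B' \<in> Pow D" "B \<noteq> B'"
      and X: "X \<in> flip B -` E \<inter> flip B' -` E"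
    have "flip B X = flip B' X"
      using X B by (intro unique) (auto simp: flip_def)
    then have "x \<in> B \<longleftrightarrow> x \<in> B'" for x
      by (drule_tac fun_cong[of _ _ x]) (auto simp: flip_def)
    then have "B = B'" by blast
    with B show False by simp
  qed
  then have "(\<Sum>B\<in>Pow D. measure coin_measure (flip B -` E)) =
      measure coin_measure (\<Union>B\<in>Pow D. flip B -` E)"
    using sets \<open>finite D\<close> by (intro coin.finite_measure_finite_Union[symmetric]) auto
  also have "\<dots> \<le> 1" by simp
  finally have "2 ^ card D * measure coin_measure E \<le> 1"
    using \<open>finite D\<close> by (simp add: meas card_Pow)
  then show ?thesis by (simp add: power_one_over field_simps)
qed

lemma stage_vimage_in_sets: "{X. P (stage c X s)} \<in> sets coin_measure"
  using initial_vimage_in_sets[of "\<lambda>i. P (stage c (bits i) s)" s]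
  by (simp add: stage_bits_initial)

lemma stuck_in_sets: "{X. stuck c j X} \<in> sets coin_measure"
proof -
  have "{X. stuck c j X} = (\<Union>s. {X. status (stage c X s) j \<ge> 1}) \<inter>
      (\<Inter>s. {X. status (stage c X s) j \<noteq> 2})"
    by (auto simp: stuck_def)
  also have "\<dots> \<in> sets coin_measure"
    by (intro sets.Int sets.countable_UN' sets.countable_INT') (auto intro: stage_vimage_in_sets)
  finally show ?thesis .
qed

text \<open>With the bits outside the block fixed, \<open>stuck_unique\<close> leaves at most one
  bad filling, so the block with its \<open>pair c j + 2\<close> positions can be the set
  \<open>D\<close> of \<open>measure_selector_le\<close>.\<close>

lemma measure_stuck_le: "measure coin_measure {X. stuck c j X} \<le> (1/2) ^ (pair c j + 2)"
proof -
  have "measure coin_measure {X. stuck c j X} \<le> (1/2) ^ card (block (pair c j))"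
    by (rule measure_selector_le[OF stuck_in_sets]) (auto simp: block_def intro: stuck_unique)
  then show ?thesis by (simp add: block_def)
qed

section \<open>Demuth tests from nested pairs of effectively open sets\<close>

primrec const_prog :: "nat \<Rightarrow> prog" where
  "const_prog 0 = PZero"
| "const_prog (Suc k) = PComp PSucc (const_prog k)"

lemma run_const_prog [simp]: "run A (const_prog k) n = Some k"
  by (induction k) simp_all

lemma computable_in_goedel_const_prog:
  assumes "computable_in A f"
  shows "computable_in A (\<lambda>x. goedel (const_prog (f x)))"
proof -
  have eq: "rec_nat (goedel PZero) (\<lambda>i r. pair 6 (pair (goedel PSucc) r)) k = goedel (const_prog k)" for k
    by (induction k) simp_all
  have "computable_in A (\<lambda>x. rec_nat (goedel PZero) (\<lambda>i r. pair 6 (pair (goedel PSucc) r)) (f x))"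
    by (intro comp_intro assms)
  then show ?thesis by (simp only: eq)
qed

text \<open>An s-m-n theorem for open sets: the parameter is hard-wired by a constant program, and
  the search ignores its counter, so it stops at once if \<open>R\<close> holds and never
  otherwise.\<close>

lemma uniformly_effectively_open:
  assumes "decidable_in no_oracle R"
  shows "\<exists>f. computable_in no_oracle f \<and>
    (\<forall>x. W (f x) = (\<Union>\<sigma>\<in>{\<sigma>. R (pair x (str_encode \<sigma>))}. cylinder \<sigma>))"
proof -
  have "decidable_in no_oracle (\<lambda>z. \<not> R (pfst z))"
    by (intro comp_intro assms[THEN decidable_in_compose])
  then obtain p where p: "\<And>z. run no_oracle p z = Some (of_bool (\<not> R (pfst z)))"
    unfolding decidable_in_def computable_in_def by blast
  define q where "q x = PComp (PMin p) (PPair (const_prog x) (PPair PFst PSnd))" for x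
  have "run no_oracle (q x) m \<noteq> None \<longleftrightarrow> R (pair x m)" for x m
    using run_PMin_decidable[of no_oracle p "\<lambda>y k. R y" "pair x m"] p
    by (simp add: q_def del: run.simps(9))
  then have "W (goedel (q x)) = (\<Union>\<sigma>\<in>{\<sigma>. R (pair x (str_encode \<sigma>))}. cylinder \<sigma>)" for x
    by (simp add: W_goedel halting_strings_def)
  moreover have "computable_in no_oracle (\<lambda>x. goedel (q x))"
    unfolding q_def goedel.simps(6,7)
    by (intro comp_intro computable_in_goedel_const_prog)
  ultimately show ?thesis by (intro exI[of _ "\<lambda>x. goedel (q x)"] conjI allI)
qed

lemma computable_in_initial_bits [comp_intro]:
  assumes "computable_in A f" "computable_in A g"
  shows "computable_in A (\<lambda>x. initial (bits (f x)) (g x))"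
  unfolding initial_eq_sum by (intro comp_intro assms[THEN computable_in_compose])

lemma initial_bits_initial: "t \<le> s \<Longrightarrow> initial (bits (initial X s)) t = initial X t"
  by (simp add: initial_def[of _ t] bits_initial) (metis less_le_trans)

lemma cbits_prefix:
  assumes "is_prefix \<sigma> X"
  shows "cbits (str_encode \<sigma>) = initial X (length \<sigma>)"
  using assms by (simp add: cbits_def initial_eq_sum is_prefix_def)

lemma prefix_of_length: "\<exists>\<sigma>. is_prefix \<sigma> X \<and> length \<sigma> = s"
  by (rule exI[of _ "map X [0..<s]"]) (simp add: is_prefix_def)

lemma computable_in_no_oracle: "computable_in no_oracle f \<longleftrightarrow> computable f"
  by (simp add: computable_in_def computable_def)

context
  fixes A B :: "nat \<Rightarrow> nat \<Rightarrow> nat \<Rightarrow> bool"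
  assumes decidable_A: "decidable_in no_oracle (\<lambda>z. A (pfst z) (pfst (psnd z)) (psnd (psnd z)))"
    and decidable_B: "decidable_in no_oracle (\<lambda>z. B (pfst z) (pfst (psnd z)) (psnd (psnd z)))"
    and mono_A: "\<And>n s t X. A n s (initial X s) \<Longrightarrow> s \<le> t \<Longrightarrow> A n t (initial X t)"
    and mono_B: "\<And>n s t X. B n s (initial X s) \<Longrightarrow> s \<le> t \<Longrightarrow> B n t (initial X t)"
    and B_imp_A: "\<And>n s X. B n s (initial X s) \<Longrightarrow> A n s (initial X s)"
    and A_0: "\<And>n X. \<not> A n 0 (initial X 0)"
    and small: "\<And>n. measure coin_measure
      {X. (\<exists>s. A n s (initial X s)) \<and> \<not> (\<exists>s. B n s (initial X s))} \<le> (1/2) ^ (n + 2)"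
begin

text \<open>
  The \<open>n\<close>-th component of the test is \<open>A\<^sub>n - B\<^sub>n[t]\<close> for the current version \<open>t\<close>. Once it is seen at
  some stage \<open>s\<close> to have measure greater than \<open>2\<^sup>-\<^sup>n\<close>, a new version is
  taken at the next stage where \<open>A\<^sub>n[s] - B\<^sub>n[s]\<close> has measure at most \<open>2\<^sup>-\<^sup>n\<^sup>-\<^sup>1\<close>.
  Between two versions the measure of \<open>A\<^sub>n[s]\<close> grows by \<open>2\<^sup>-\<^sup>n\<^sup>-\<^sup>1\<close>, which bounds their number.
\<close>

definition excess :: "nat \<Rightarrow> nat \<Rightarrow> nat \<Rightarrow> nat" where
  "excess n t s = (\<Sum>i<2 ^ s. of_bool (A n s i \<and> \<not> B n t (initial (bits i) t)))"

definition version :: "nat \<Rightarrow> nat \<Rightarrow> nat" where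
  "version n s = rec_nat 0 (\<lambda>s t. if 2 ^ s < 2 ^ n * excess n t s \<and>
     2 ^ (n + 1) * excess n s s \<le> 2 ^ s then s else t) s"

definition A_set :: "nat \<Rightarrow> nat \<Rightarrow> cantor set" where
  "A_set n s = {X. A n s (initial X s)}"

definition B_set :: "nat \<Rightarrow> nat \<Rightarrow> cantor set" where
  "B_set n s = {X. B n s (initial X s)}"

lemma decidable_in_A:
  assumes "computable_in no_oracle f" "computable_in no_oracle g" "computable_in no_oracle h"
  shows "decidable_in no_oracle (\<lambda>x. A (f x) (g x) (h x))"
  using decidable_in_compose[OF decidable_A, of "\<lambda>x. pair (f x) (pair (g x) (h x))"] assms
  by (simp add: comp_intro)

lemma decidable_in_B:
  assumes "computable_in no_oracle f" "computable_in no_oracle g" "computable_in no_oracle h"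
  shows "decidable_in no_oracle (\<lambda>x. B (f x) (g x) (h x))"
  using decidable_in_compose[OF decidable_B, of "\<lambda>x. pair (f x) (pair (g x) (h x))"] assms
  by (simp add: comp_intro)

lemma computable_in_excess:
  assumes "computable_in no_oracle f" "computable_in no_oracle g" "computable_in no_oracle h"
  shows "computable_in no_oracle (\<lambda>x. excess (f x) (g x) (h x))"
  unfolding excess_def
  by (intro comp_intro decidable_in_A decidable_in_B assms[THEN computable_in_compose])

lemma computable_in_version:
  assumes "computable_in no_oracle f" "computable_in no_oracle g"
  shows "computable_in no_oracle (\<lambda>x. version (f x) (g x))"
  unfolding version_def
  by (intro comp_intro computable_in_excess assms[THEN computable_in_compose])

lemma sets_A_B: "A_set n s \<in> sets coin_measure" "B_set n s \<in> sets coin_measure"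
  unfolding A_set_def B_set_def by (rule initial_vimage_in_sets)+

lemma A_set_mono: "s \<le> t \<Longrightarrow> A_set n s \<subseteq> A_set n t"
  and B_set_mono: "s \<le> t \<Longrightarrow> B_set n s \<subseteq> B_set n t"
  and B_subset_A: "B_set n s \<subseteq> A_set n s"
  unfolding A_set_def B_set_def using mono_A mono_B B_imp_A by blast+

text \<open>Both sets depend on the first \<open>s\<close> bits only, so measuring amounts to
  counting; this is why \<open>version\<close> can compare integers.\<close>

lemma measure_diff:
  assumes "t \<le> s"
  shows "measure coin_measure (A_set n s) - measure coin_measure (B_set n t) = excess n t s / 2 ^ s"
proof -
  have "B_set n t \<subseteq> A_set n s"
    using B_subset_A A_set_mono[OF assms] by blast
  then have "measure coin_measure (A_set n s) - measure coin_measure (B_set n t) =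
      measure coin_measure (A_set n s - B_set n t)"
    by (simp add: coin.finite_measure_Diff sets_A_B)
  also have "A_set n s - B_set n t =
      {X. A n s (initial X s) \<and> \<not> B n t (initial (bits (initial X s)) t)}"
    using assms by (auto simp: A_set_def B_set_def initial_bits_initial)
  also have "measure coin_measure \<dots> =
      card {i. i < 2 ^ s \<and> (A n s i \<and> \<not> B n t (initial (bits i) t))} / 2 ^ s"
    by (rule measure_initial_vimage)
  also have "card {i. i < 2 ^ s \<and> (A n s i \<and> \<not> B n t (initial (bits i) t))} = excess n t s"
    by (simp add: excess_def Int_def)
  finally show ?thesis .
qed

lemma version_0: "version n 0 = 0"
  by (simp add: version_def)

lemma version_Suc:
  "version n (Suc s) = (if 2 ^ s < 2 ^ n * excess n (version n s) s \<and>
     2 ^ (n + 1) * excess n s s \<le> 2 ^ s then s else version n s)"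
  by (simp add: version_def)

lemma version_le: "version n s \<le> s"
  by (induction s) (auto simp: version_0 version_Suc)

lemma version_step:
  "version n (Suc s) =
    (if measure coin_measure (A_set n s) - measure coin_measure (B_set n (version n s)) > (1/2) ^ n \<and>
        measure coin_measure (A_set n s) - measure coin_measure (B_set n s) \<le> (1/2) ^ (n + 1)
     then s else version n s)"
proof -
  have "2 ^ s < 2 ^ n * excess n t s \<longleftrightarrow> (1/2) ^ n < excess n t s / 2 ^ s" for t
  proof -
    have "2 ^ s < 2 ^ n * excess n t s \<longleftrightarrow> real (2 ^ s) < real (2 ^ n * excess n t s)"
      by (simp only: of_nat_less_iff)
    then show ?thesis by (simp add: field_simps power_one_over)
  qed
  moreover have "2 ^ (n + 1) * excess n s s \<le> 2 ^ s \<longleftrightarrow> excess n s s / 2 ^ s \<le> (1/2) ^ (n + 1)"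
  proof -
    have "2 ^ (n + 1) * excess n s s \<le> 2 ^ s \<longleftrightarrow> real (2 ^ (n + 1) * excess n s s) \<le> real (2 ^ s)"
      by (simp only: of_nat_le_iff)
    then show ?thesis by (simp add: field_simps power_one_over)
  qed
  ultimately show ?thesis
    unfolding version_Suc measure_diff[OF version_le] measure_diff[OF order_refl] by simp
qed

lemma version_small:
  "measure coin_measure (A_set n (version n s)) - measure coin_measure (B_set n (version n s))
    \<le> (1/2) ^ (n + 1)"
proof (induction s)
  case 0
  have "A_set n 0 = {}"
    using A_0 by (auto simp: A_set_def)
  moreover from this have "B_set n 0 = {}"
    using B_subset_A[of n 0] by simp
  ultimately show ?case by (simp add: version_0)
qed (simp add: version_step)

lemma card_version_changes:
  "card {s. s < N \<and> version n s \<noteq> version n (Suc s)} * (1/2) ^ (n + 1)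
    \<le> measure coin_measure (A_set n (version n N))"
proof (induction N)
  case (Suc N)
  let ?F = "\<lambda>N. {s. s < N \<and> version n s \<noteq> version n (Suc s)}"
  show ?case
  proof (cases "version n N = version n (Suc N)")
    case True
    then have "?F (Suc N) = ?F N" by (auto simp: less_Suc_eq)
    with True Suc show ?thesis by simp
  next
    case False
    then have F: "?F (Suc N) = insert N (?F N)" by auto
    have "measure coin_measure (A_set n N) - measure coin_measure (B_set n (version n N)) > (1/2) ^ n"
      and N: "version n (Suc N) = N"
      using False by (auto simp: version_step split: if_splits)
    \<comment> \<open>Against the same frozen set the difference rose from at most
      \<open>2^-(n+1)\<close> to more than \<open>2^-n\<close>, so the started waits gained more
      than \<open>2^-(n+1)\<close>.\<close>
    with version_small[of n N] Suc show ?thesis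
      unfolding F N by (simp add: algebra_simps)
  qed
qed simp

lemma version_changes:
  "finite {s. version n s \<noteq> version n (Suc s)} \<and>
   card {s. version n s \<noteq> version n (Suc s)} \<le> 2 ^ (n + 1)"
proof (rule finite_if_finite_subsets_card_bdd)
  fix G assume G: "G \<subseteq> {s. version n s \<noteq> version n (Suc s)}" "finite G"
  define N where "N = Suc (Max (insert 0 G))"
  have "G \<subseteq> {s. s < N \<and> version n s \<noteq> version n (Suc s)}"
    using G by (auto simp: N_def less_Suc_eq_le)
  then have "card G \<le> card {s. s < N \<and> version n s \<noteq> version n (Suc s)}"
    by (intro card_mono) auto
  also have "real \<dots> * (1/2) ^ (n + 1) \<le> 1"
    using card_version_changes[of N n] coin.prob_le_1[of "A_set n (version n N)"] by linarith
  then have "real (card {s. s < N \<and> version n s \<noteq> version n (Suc s)}) \<le> real (2 ^ (n + 1))"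
    by (simp add: field_simps power_one_over)
  then have "card {s. s < N \<and> version n s \<noteq> version n (Suc s)} \<le> 2 ^ (n + 1)"
    by (simp only: of_nat_le_iff)
  finally show "card G \<le> 2 ^ (n + 1)" .
qed

lemma version_eventually_const:
  obtains T where "\<forall>\<^sub>F s in sequentially. version n s = T"
proof -
  obtain r where r: "\<And>s. version n s \<noteq> version n (Suc s) \<Longrightarrow> s < r"
    using version_changes[of n] unfolding finite_nat_set_iff_bounded by blast
  have "version n s = version n r" if "r \<le> s" for s
    using that
  proof (induction rule: dec_induct)
    case (step s)
    then have "version n s = version n (Suc s)" using r[of s] by (meson not_less)
    with step.IH show ?case by simp
  qed simp
  then have "\<forall>\<^sub>F s in sequentially. version n s = version n r"
    by (rule eventually_sequentiallyI)
  then show ?thesis by (rule that)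
qed

lemma measure_version_limit:
  assumes T: "\<forall>\<^sub>F s in sequentially. version n s = T"
  shows "measure coin_measure ((\<Union>s. A_set n s) - B_set n T) \<le> (1/2) ^ n"
proof -
  let ?\<alpha> = "\<lambda>s. measure coin_measure (A_set n s)" and ?\<beta> = "\<lambda>s. measure coin_measure (B_set n s)"
  have lim_A: "?\<alpha> \<longlonglongrightarrow> measure coin_measure (\<Union>s. A_set n s)"
    using A_set_mono by (intro coin.finite_Lim_measure_incseq) (auto simp: sets_A_B incseq_def)
  have lim_B: "?\<beta> \<longlonglongrightarrow> measure coin_measure (\<Union>s. B_set n s)"
    using B_set_mono by (intro coin.finite_Lim_measure_incseq) (auto simp: sets_A_B incseq_def)
  have sets: "(\<Union>s. A_set n s) \<in> sets coin_measure" "(\<Union>s. B_set n s) \<in> sets coin_measure"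
    by (auto intro!: sets.countable_UN simp: sets_A_B)
  have sub: "(\<Union>s. B_set n s) \<subseteq> (\<Union>s. A_set n s)" using B_subset_A by blast
  have "measure coin_measure (\<Union>s. A_set n s) - measure coin_measure (\<Union>s. B_set n s) =
      measure coin_measure ((\<Union>s. A_set n s) - (\<Union>s. B_set n s))"
    using sub sets by (simp add: coin.finite_measure_Diff)
  also have "(\<Union>s. A_set n s) - (\<Union>s. B_set n s) =
      {X. (\<exists>s. A n s (initial X s)) \<and> \<not> (\<exists>s. B n s (initial X s))}"
    by (auto simp: A_set_def B_set_def)
  also have "measure coin_measure \<dots> < (1/2) ^ (n + 1)"
    using small[of n] by (rule order.strict_trans1) simp
  \<comment> \<open>The strict bound at the limit passes to all late stages, so from some point on
    every stage would be an acceptable version.\<close>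
  finally have "\<forall>\<^sub>F s in sequentially. ?\<alpha> s - ?\<beta> s < (1/2) ^ (n + 1)"
    using order_tendstoD(2)[OF tendsto_diff[OF lim_A lim_B]] by blast
  then have ev: "\<forall>\<^sub>F s in sequentially. ?\<alpha> s - ?\<beta> s < (1/2) ^ (n + 1) \<and>
      version n s = T \<and> version n (Suc s) = T \<and> T < s"
    using T eventually_sequentially_Suc[of "\<lambda>s. version n s = T"] eventually_gt_at_top[of T]
    by (intro eventually_conj) simp_all
  \<comment> \<open>Late stages are acceptable and differ from \<open>T\<close>. As the version
    stays \<open>T\<close> nonetheless, it is the other condition for a revision that fails.\<close>
  have "\<forall>\<^sub>F s in sequentially. ?\<alpha> s \<le> ?\<beta> T + (1/2) ^ n"
    using ev
  proof eventually_elim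
    case (elim s)
    then show ?case using version_step[of n s] by (auto split: if_splits)
  qed
  then have "measure coin_measure (\<Union>s. A_set n s) \<le> ?\<beta> T + (1/2) ^ n"
    by (intro tendsto_upperbound[OF lim_A]) auto
  moreover have "measure coin_measure ((\<Union>s. A_set n s) - B_set n T) =
      measure coin_measure (\<Union>s. A_set n s) - ?\<beta> T"
    using sub sets by (intro coin.finite_measure_Diff) (auto simp: sets_A_B)
  ultimately show ?thesis by simp
qed

lemma demuth_random_avoids:
  assumes "demuth_random X"
  shows "finite {n. (\<exists>s. A n s (initial X s)) \<and> \<not> (\<exists>s. B n s (initial X s))}"
proof -
  define R where "R z \<longleftrightarrow> psnd (pfst z) \<le> clen (psnd z) \<and>
      A (pfst (pfst z)) (clen (psnd z)) (cbits (psnd z)) \<and>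
      \<not> B (pfst (pfst z)) (psnd (pfst z)) (initial (bits (cbits (psnd z))) (psnd (pfst z)))" for z
  have R: "decidable_in no_oracle R"
    unfolding R_def[abs_def] by (intro comp_intro decidable_in_A decidable_in_B)
  obtain f where f_W: "computable_in no_oracle f \<and>
      (\<forall>x. W (f x) = (\<Union>\<sigma>\<in>{\<sigma>. R (pair x (str_encode \<sigma>))}. cylinder \<sigma>))"
    using uniformly_effectively_open[OF R] ..
  note f = f_W[THEN conjunct1] and W = f_W[THEN conjunct2, rule_format]
  have W': "W (f (pair n t)) = (\<Union>s. A_set n s) - B_set n t" for n t
  proof (rule set_eqI)
    fix X
    have "X \<in> W (f (pair n t)) \<longleftrightarrow> (\<exists>\<sigma>. is_prefix \<sigma> X \<and> t \<le> length \<sigma> \<and>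
        A n (length \<sigma>) (initial X (length \<sigma>)) \<and> \<not> B n t (initial X t))"
      by (auto simp: W R_def cylinder_def cbits_prefix initial_bits_initial)
    also have "\<dots> \<longleftrightarrow> (\<exists>s. A n s (initial X s)) \<and> \<not> B n t (initial X t)"
    proof (intro iffI; elim conjE exE)
      fix s assume *: "A n s (initial X s)" "\<not> B n t (initial X t)"
      obtain \<sigma> where "is_prefix \<sigma> X" "length \<sigma> = max s t"
        using prefix_of_length by blast
      moreover have "A n (max s t) (initial X (max s t))"
        using mono_A[OF *(1)] by simp
      ultimately show "\<exists>\<sigma>. is_prefix \<sigma> X \<and> t \<le> length \<sigma> \<and>
          A n (length \<sigma>) (initial X (length \<sigma>)) \<and> \<not> B n t (initial X t)"
        using *(2) by (intro exI[of _ \<sigma>]) simp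
    qed blast
    finally show "X \<in> W (f (pair n t)) \<longleftrightarrow> X \<in> (\<Union>s. A_set n s) - B_set n t"
      by (auto simp: A_set_def B_set_def)
  qed
  have "\<forall>n. \<exists>T. \<forall>\<^sub>F s in sequentially. version n s = T"
    using version_eventually_const by metis
  then obtain T where T: "\<And>n. \<forall>\<^sub>F s in sequentially. version n s = T n" by metis
  define g where "g n = f (pair n (T n))" for n
  define ga where "ga n s = f (pair n (version n s))" for n s
  have "computable2 ga"
    unfolding computable2_def computable_in_no_oracle[symmetric] ga_def split_beta
      pfst_def[symmetric] psnd_def[symmetric]
    by (intro comp_intro computable_in_version f[THEN computable_in_compose])
  moreover have "\<forall>\<^sub>F s in sequentially. ga n s = g n" for n
    using T[of n] by eventually_elim (simp add: ga_def g_def)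
  moreover have "computable (\<lambda>n. 2 ^ (n + 1))"
    unfolding computable_in_no_oracle[symmetric] by (intro comp_intro)
  moreover have "finite {s. ga n s \<noteq> ga n (Suc s)} \<and>
      card {s. ga n s \<noteq> ga n (Suc s)} \<le> 2 ^ (n + 1)" for n
  proof -
    have "{s. ga n s \<noteq> ga n (Suc s)} \<subseteq> {s. version n s \<noteq> version n (Suc s)}"
      by (auto simp: ga_def)
    with version_changes[of n] show ?thesis
      by (meson card_mono finite_subset le_trans)
  qed
  ultimately have "omega_ca g" unfolding omega_ca_def by blast
  moreover have "measure coin_measure (W (g n)) \<le> (1/2) ^ n" for n
    unfolding g_def W' by (rule measure_version_limit[OF T])
  ultimately have "finite {n. X \<in> W (g n)}"
    using assms unfolding demuth_random_def demuth_test_def by blast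
  then show ?thesis
    by (rule finite_subset[rotated]) (auto simp: g_def W' A_set_def B_set_def)
qed

end

section \<open>Choice of the parameter \<open>c\<close>\<close>

lemma demuth_random_not_stuck:
  assumes "demuth_random X"
  shows "\<exists>c. \<forall>j. \<not> stuck c j X"
proof -
  define A where "A n s i \<longleftrightarrow> status (stage (pfst n) (bits i) s) (psnd n) \<ge> 1" for n s i
  define B where "B n s i \<longleftrightarrow> status (stage (pfst n) (bits i) s) (psnd n) = 2" for n s i
  have A: "A n s (initial X s) \<longleftrightarrow> status (stage (pfst n) X s) (psnd n) \<ge> 1" for n s X
    by (simp add: A_def stage_bits_initial)
  have B: "B n s (initial X s) \<longleftrightarrow> status (stage (pfst n) X s) (psnd n) = 2" for n s X
    by (simp add: B_def stage_bits_initial)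
  have stuck: "{X. (\<exists>s. A n s (initial X s)) \<and> \<not> (\<exists>s. B n s (initial X s))} =
      {X. stuck (pfst n) (psnd n) X}" for n
    unfolding A B stuck_def by simp
  have "finite {n. (\<exists>s. A n s (initial X s)) \<and> \<not> (\<exists>s. B n s (initial X s))}"
  proof (rule demuth_random_avoids)
    show "decidable_in no_oracle (\<lambda>z. A (pfst z) (pfst (psnd z)) (psnd (psnd z)))"
      "decidable_in no_oracle (\<lambda>z. B (pfst z) (pfst (psnd z)) (psnd (psnd z)))"
      unfolding A_def B_def by (intro comp_intro)+
    show "A n t (initial X t)" if "A n s (initial X s)" "s \<le> t" for n s t X
      using that status_stage_mono[of s t] unfolding A by (meson le_trans)
    show "B n t (initial X t)" if "B n s (initial X s)" "s \<le> t" for n s t X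
      using that status_stage_mono[of s t "pfst n" X "psnd n"] status_le_2[of "pfst n" X t "psnd n"]
      unfolding B by simp
    show "A n s (initial X s)" if "B n s (initial X s)" for n s X
      using that unfolding A B by simp
    show "\<not> A n 0 (initial X 0)" for n X
      unfolding A by simp
    show "measure coin_measure {X. (\<exists>s. A n s (initial X s)) \<and> \<not> (\<exists>s. B n s (initial X s))}
        \<le> (1/2) ^ (n + 2)" for n
      unfolding stuck using measure_stuck_le[of "pfst n" "psnd n"] by simp
  qed (rule assms)
  then obtain N where N: "\<And>n. (\<exists>s. A n s (initial X s)) \<and> \<not> (\<exists>s. B n s (initial X s)) \<Longrightarrow> n < N"
    unfolding finite_nat_set_iff_bounded by blast
  \<comment> \<open>Every index \<open>pair N j\<close> is at least \<open>N\<close>, hence beyond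
    all failures of \<open>X\<close>. Nothing here computes this \<open>N\<close> from
    \<open>X\<close>; its existence is enough, since it is hard-wired into the reduction.\<close>
  have "\<not> stuck N j X" for j
  proof
    assume "stuck N j X"
    then have "pair N j < N" using N[of "pair N j"] stuck[of "pair N j"] by auto
    with le_prod_encode_1[of N j] show False by simp
  qed
  then show ?thesis by blast
qed

theorem theorem3p2:
  fixes X :: cantor
  assumes "demuth_random X"
  shows "\<exists>G. one_generic G \<and> G \<le>\<^sub>T X"
  using demuth_random_not_stuck[OF assms] one_generic_limit limit_le by blast

end
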